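(* Let $$\widehat F_1(s)=\frac12\int_s^\infty\mathrm{Ai}(x)\,dx,\qquad \widehat F_2(s)=\int_s^\infty\bigl(\mathrm{Ai}'(x)^2-x\,\mathrm{Ai}(x)^2\bigr)dx,$$ and let $F_{\mathsf{TW}_1}(s)$, $F_{\mathsf{TW}_2}(s)$ be the upper tail probability functions of the Tracy–Widom distributions of the first and second kinds. Define $$\Delta_\beta(s)=\frac{\widehat F_\beta(s)-F_{\mathsf{TW}_\beta}(s)}{F_{\mathsf{TW}_\beta}(s)},\qquad\beta=1,2.$$ Then, as $s\to\infty$, $$\Delta_1(s)\sim-\frac{1}{2^5\pi^{1/2}}\,s^{-9/4}e^{-\frac23s^{3/2}},\qquad \Delta_2(s)\sim\frac{1}{2^{10}\pi}\,s^{-9/2}e^{-\frac43s^{3/2}}.$$ In particular $\Delta_2(s)\sim\Delta_1(s)^2$.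
   Context: $\mathrm{Ai}$ is the Airy function of the first kind. $f\sim g$ means $f/g\to1$. Let $q$ be the solution of the Painlevé II equation $q''=2q^3+xq$ with $q(x)\sim\mathrm{Ai}(x)$ as $x\to\infty$ (Hastings–McLeod solution). The Tracy–Widom upper tail probabilities (one minus the distribution function) are $$F_{\mathsf{TW}_1}(s)=1-\exp\Bigl(-\tfrac12\int_s^\infty\bigl[q(x)+(x-s)q(x)^2\bigr]dx\Bigr),\qquad F_{\mathsf{TW}_2}(s)=1-\exp\Bigl(-\int_s^\infty(x-s)q(x)^2\,dx\Bigr).$$ *)

theory Defs
  imports "HOL-Analysis.Analysis" "HOL-Library.Landau_Symbols"
begin

text \<open>
  \<open>Ai\<close> is given by its classical integral representation
  \<open>Ai(x) = 1/pi * int_0^oo cos(t^3/3 + x t) dt\<close>.  The integral converges only conditionally,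
  so it must be read as an improper integral, i.e. as the limit of the integrals over
  \<open>[0, b]\<close>; a Lebesgue integral over \<open>[0, oo)\<close> would not exist.
\<close>

definition Ai :: "real \<Rightarrow> real" where
  "Ai x = Lim at_top (\<lambda>b. integral {0..b} (\<lambda>t. cos (t ^ 3 / 3 + x * t))) / pi"

definition hastings_mcleod :: "(real \<Rightarrow> real) \<Rightarrow> bool" where
  "hastings_mcleod q \<longleftrightarrow>
     (\<forall>x. q differentiable (at x) \<and>
          (deriv q has_real_derivative 2 * q x ^ 3 + x * q x) (at x)) \<and>
     q \<sim>[at_top] Ai"

text \<open>
  Upper tail probabilities (one minus the distribution function) of the Tracy--Widom
  distributions, expressed through the Hastings--McLeod solution \<open>q\<close>.
\<close>

definition F_TW1 :: "(real \<Rightarrow> real) \<Rightarrow> real \<Rightarrow> real" where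
  "F_TW1 q s = 1 - exp (- (1 / 2) * integral {s..} (\<lambda>x. q x + (x - s) * (q x)\<^sup>2))"

definition F_TW2 :: "(real \<Rightarrow> real) \<Rightarrow> real \<Rightarrow> real" where
  "F_TW2 q s = 1 - exp (- integral {s..} (\<lambda>x. (x - s) * (q x)\<^sup>2))"

definition Fhat1 :: "real \<Rightarrow> real" where
  "Fhat1 s = 1 / 2 * integral {s..} Ai"

definition Fhat2 :: "real \<Rightarrow> real" where
  "Fhat2 s = integral {s..} (\<lambda>x. (deriv Ai x)\<^sup>2 - x * (Ai x)\<^sup>2)"

definition Delta1 :: "(real \<Rightarrow> real) \<Rightarrow> real \<Rightarrow> real" where
  "Delta1 q s = (Fhat1 s - F_TW1 q s) / F_TW1 q s"

definition Delta2 :: "(real \<Rightarrow> real) \<Rightarrow> real \<Rightarrow> real" where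
  "Delta2 q s = (Fhat2 s - F_TW2 q s) / F_TW2 q s"

end

theory Submission
  imports
    Defs
    "HOL-Probability.Distributions"
    "HOL-Complex_Analysis.Cauchy_Integral_Theorem"
    "HOL-Real_Asymp.Real_Asymp"
begin

text \<open>
  Shifting the contour of the Airy integral to the saddle point gives \<open>Ai'' = x Ai\<close> and the leading
  asymptotics of \<open>Ai\<close>.  Afterwards every quantity is compared with monomials \<open>Ai\<^sup>m x\<^sup>j\<close>: by L'Hospital's rule,
  \<open>F' \<sim> c Ai\<^sup>m x\<^sup>j\<close> and \<open>F \<longlongrightarrow> 0\<close> give \<open>F \<sim> - (c / m) Ai\<^sup>m x powr (j - 1/2)\<close>, so leading terms
  can be integrated, and terms with more factors \<open>Ai\<close> are negligible.

  The leading terms of \<open>Fhat - F_TW\<close> cancel (once for \<open>\<beta> = 1\<close>, twice for \<open>\<beta> = 2\<close>).  No higher-order expansion of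
  \<open>Ai\<close> is needed to resolve this, since differentiating the cancelling combinations sufficiently often turns
  them into single monomials.  For \<open>\<beta> = 2\<close> this rests on the function \<open>p = (Ai' / Ai)\<^sup>2 - x\<close>, for
  which \<open>(Ai\<^sup>2 p)' = - Ai\<^sup>2\<close>, \<open>(Ai\<^sup>2 p')' = 2 Ai\<^sup>2 p\<^sup>2\<close> and \<open>(Ai\<^sup>2 (2 p\<^sup>3 + p'))' = 4 Ai\<^sup>2 p\<^sup>2 p'\<close>.
\<close>

section \<open>Integrals with exponentially small tails\<close>

text \<open>Of \<open>q\<close> only \<open>q ~ Ai\<close> and Painleve II are known, so its
  correction must be produced first: the Wronskian of \<open>q\<close> and \<open>Ai\<close> has
  derivative \<open>2 Ai q^3\<close>, free of the linear term, and two integrations give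
  \<open>q = Ai (1 + y)\<close> with \<open>y ~ Ai^2 / (4 x)\<close>. For beta = 2 let
  \<open>v\<close> be the integral in \<open>F_TW2\<close>. Then \<open>Fhat2 - F_TW2\<close> is
  \<open>Fhat2 - v + v^2 / 2\<close> up to \<open>O(v^3)\<close>. Here \<open>v - Fhat2\<close> is
  caused by \<open>y\<close> alone, and both it and \<open>v^2 / 2\<close> are
  \<open>~ Ai^4 / (32 x^2)\<close>. The next order in \<open>x powr (- 3 / 2)\<close> cancels as
  well; what survives is \<open>Ai^4 / (1024 x^5)\<close>, and division by
  \<open>F_TW2 ~ Ai^2 / (4 x)\<close> gives \<open>Ai^2 / (256 x^4)\<close>. For beta = 1 the
  correction \<open>y\<close> enters only with three factors of \<open>Ai\<close>. The quadratic
  terms, \<open>- v / 2\<close> from the exponent and half the square of the exponent, are both of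
  size \<open>Ai^2 / (8 x)\<close>; they leave \<open>- Ai^2 x powr (- 5 / 2) / 32\<close>, and
  division by \<open>F_TW1 ~ Ai / (2 sqrt x)\<close> gives \<open>- Ai / (16 x^2)\<close>.\<close>

lemma eventually_at_top_ge_self:
  "eventually P (at_top :: real filter) \<Longrightarrow> \<forall>\<^sub>F x in at_top. \<forall>y\<ge>x. P y"
  by (auto simp: eventually_at_top_linorder intro: order_trans)

section \<open>Sign arguments and L'Hospital's rule at infinity\<close>

lemma eventually_nonneg_if_deriv_nonpos:
  fixes H H' :: "real \<Rightarrow> real"
  assumes "\<forall>\<^sub>F x in at_top. (H has_real_derivative H' x) (at x)"
    and "\<forall>\<^sub>F x in at_top. H' x \<le> 0" and lim: "(H \<longlongrightarrow> 0) at_top"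
  shows "\<forall>\<^sub>F x in at_top. H x \<ge> 0"
proof -
  have "\<forall>\<^sub>F x in at_top. \<forall>y\<ge>x. (H has_real_derivative H' y) (at y) \<and> H' y \<le> 0"
    using assms(1,2) by (intro eventually_at_top_ge_self eventually_conj)
  then show ?thesis
  proof eventually_elim
    case (elim x)
    have "H y \<le> H x" if "y \<ge> x" for y
      by (rule DERIV_nonpos_imp_nonincreasing[OF that]) (use elim in blast)
    then have "\<forall>\<^sub>F y in at_top. H y \<le> H x"
      by (auto simp: eventually_at_top_linorder)
    then show "H x \<ge> 0"
      using tendsto_upperbound[OF lim] by simp
  qed
qed

lemma eventually_pos_if_deriv_neg:
  fixes H H' :: "real \<Rightarrow> real"
  assumes D: "\<forall>\<^sub>F x in at_top. (H has_real_derivative H' x) (at x)"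
    and neg: "\<forall>\<^sub>F x in at_top. H' x < 0" and lim: "(H \<longlongrightarrow> 0) at_top"
  shows "\<forall>\<^sub>F x in at_top. H x > 0"
proof -
  have "\<forall>\<^sub>F x in at_top. H x \<ge> 0"
    by (rule eventually_nonneg_if_deriv_nonpos[OF D _ lim]) (use neg in \<open>auto elim: eventually_mono\<close>)
  with D neg have "\<forall>\<^sub>F x in at_top. \<forall>y\<ge>x. (H has_real_derivative H' y) (at y) \<and> H' y < 0 \<and> H y \<ge> 0"
    by (intro eventually_at_top_ge_self eventually_conj)
  then show ?thesis
  proof eventually_elim
    case (elim x)
    have "H (x + 1) < H x"
      by (rule DERIV_neg_imp_decreasing[of x "x + 1"]) (use elim in \<open>auto intro!: exI\<close>)
    moreover have "H (x + 1) \<ge> 0" using elim by simp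
    ultimately show ?case by linarith
  qed
qed

text \<open>Once \<open>|F' - L G'| <= - d G'\<close>, both \<open>d G + (F - L G)\<close> and
  \<open>d G - (F - L G)\<close> have nonpositive derivative and limit 0, hence are nonnegative.
  Dividing by \<open>G > 0\<close> gives \<open>|F / G - L| <= d\<close>.\<close>

lemma lhopital_zero_at_top:
  fixes F F' G G' :: "real \<Rightarrow> real"
  assumes F: "(F \<longlongrightarrow> 0) at_top" and G: "(G \<longlongrightarrow> 0) at_top"
    and F': "\<forall>\<^sub>F x in at_top. (F has_real_derivative F' x) (at x)"
    and G': "\<forall>\<^sub>F x in at_top. (G has_real_derivative G' x) (at x)"
    and neg: "\<forall>\<^sub>F x in at_top. G' x < 0"
    and L: "((\<lambda>x. F' x / G' x) \<longlongrightarrow> L) at_top"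
  shows "((\<lambda>x. F x / G x) \<longlongrightarrow> L) at_top"
proof (rule tendstoI)
  fix e :: real assume "e > 0"
  define d where "d = e / 2"
  have d: "d > 0" "d < e" using \<open>e > 0\<close> by (auto simp: d_def)
  from tendstoD[OF L \<open>d > 0\<close>] neg
  have ev: "\<forall>\<^sub>F x in at_top. \<bar>F' x - L * G' x\<bar> \<le> - d * G' x"
  proof eventually_elim
    case (elim x)
    have "\<bar>F' x / G' x - L\<bar> * (- G' x) \<le> d * (- G' x)"
      using elim by (intro mult_right_mono) (auto simp: dist_real_def)
    moreover have "\<bar>F' x / G' x - L\<bar> * (- G' x) = \<bar>F' x - L * G' x\<bar>"
    proof -
      have "\<bar>F' x / G' x - L\<bar> * (- G' x) = \<bar>(F' x / G' x - L) * G' x\<bar>"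
        using elim by (simp add: abs_mult)
      also have "(F' x / G' x - L) * G' x = F' x - L * G' x"
        using elim by (simp add: field_simps)
      finally show ?thesis .
    qed
    ultimately show ?case by simp
  qed
  have bnd: "\<forall>\<^sub>F x in at_top. d * G x + \<sigma> * (F x - L * G x) \<ge> 0" if "\<bar>\<sigma>\<bar> = 1" for \<sigma> :: real
  proof (rule eventually_nonneg_if_deriv_nonpos)
    show "\<forall>\<^sub>F x in at_top. ((\<lambda>x. d * G x + \<sigma> * (F x - L * G x)) has_real_derivative
        d * G' x + \<sigma> * (F' x - L * G' x)) (at x)"
      using F' G' by eventually_elim (auto intro!: derivative_eq_intros)
    show "\<forall>\<^sub>F x in at_top. d * G' x + \<sigma> * (F' x - L * G' x) \<le> 0"
      using ev
    proof eventually_elim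
      case (elim x)
      have "\<sigma> * (F' x - L * G' x) \<le> \<bar>\<sigma> * (F' x - L * G' x)\<bar>" by simp
      also have "\<dots> = \<bar>F' x - L * G' x\<bar>" using that by (simp add: abs_mult)
      finally show ?case using elim by simp
    qed
    show "((\<lambda>x. d * G x + \<sigma> * (F x - L * G x)) \<longlongrightarrow> 0) at_top"
      by (rule tendsto_eq_intros F G refl | simp)+
  qed
  have "\<forall>\<^sub>F x in at_top. G x > 0"
    by (rule eventually_pos_if_deriv_neg[OF G' neg G])
  with bnd[of 1, simplified] bnd[of "-1", simplified]
  show "\<forall>\<^sub>F x in at_top. dist (F x / G x) L < e"
  proof eventually_elim
    case (elim x)
    have "\<bar>F x / G x - L\<bar> * G x = \<bar>(F x / G x - L) * G x\<bar>"
      using elim by (simp add: abs_mult)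
    also have "(F x / G x - L) * G x = F x - L * G x"
      using elim by (simp add: field_simps)
    also have "\<bar>\<dots>\<bar> \<le> d * G x" using elim by (simp add: abs_le_iff)
    finally have "\<bar>F x / G x - L\<bar> \<le> d" using elim by simp
    then show ?case using d by (simp add: dist_real_def)
  qed
qed

text \<open>Since \<open>f'\<close> is nondecreasing, the mean value theorem traps
  \<open>f' x\<close> between \<open>f x - f (x - 1)\<close> and \<open>f (x + 1) - f x\<close>,
  which both tend to 0. This supplies the limits of \<open>Ai'\<close> and \<open>q'\<close>, about
  which nothing is known beforehand.\<close>

lemma deriv_tendsto_zero_if_convex:
  fixes f f' f'' :: "real \<Rightarrow> real"
  assumes f: "(f \<longlongrightarrow> 0) at_top"
    and f': "\<forall>\<^sub>F x in at_top. (f has_real_derivative f' x) (at x)"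
    and f'': "\<forall>\<^sub>F x in at_top. (f' has_real_derivative f'' x) (at x)"
    and convex: "\<forall>\<^sub>F x in at_top. f'' x \<ge> 0"
  shows "(f' \<longlongrightarrow> 0) at_top"
proof -
  have ev: "\<forall>\<^sub>F x in at_top. \<forall>y\<ge>x. (f has_real_derivative f' y) (at y) \<and>
      (f' has_real_derivative f'' y) (at y) \<and> f'' y \<ge> 0"
    using f' f'' convex by (intro eventually_at_top_ge_self eventually_conj)
  have ev2: "\<forall>\<^sub>F x in at_top. f' x \<le> f (x + 1) - f x \<and> f (x + 1) - f x \<le> f' (x + 1)"
    using ev
  proof eventually_elim
    case (elim x)
    then obtain z where z: "z > x" "z < x + 1" "f (x + 1) - f x = (x + 1 - x) * f' z"
      using MVT2[of x "x + 1" f f'] by force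
    have "f' a \<le> f' b" if "x \<le> a" "a \<le> b" for a b
    proof (rule DERIV_nonneg_imp_nondecreasing[OF that(2)])
      fix t assume "a \<le> t"
      then have "x \<le> t" using that by simp
      with elim show "\<exists>y. (f' has_real_derivative y) (at t) \<and> 0 \<le> y" by blast
    qed
    from this[of x z] this[of z "x + 1"] show ?case using z by simp
  qed
  have sh: "filterlim (\<lambda>x::real. x - 1) at_top at_top" "filterlim (\<lambda>x::real. x + 1) at_top at_top"
    by real_asymp+
  have "((\<lambda>x. f x - f (x - 1)) \<longlongrightarrow> 0) at_top"
    using tendsto_diff[OF f filterlim_compose[OF f sh(1)]] by simp
  moreover have "((\<lambda>x. f (x + 1) - f x) \<longlongrightarrow> 0) at_top"
    using tendsto_diff[OF filterlim_compose[OF f sh(2)] f] by simp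
  moreover have "\<forall>\<^sub>F x in at_top. f x - f (x - 1) \<le> f' x"
    using eventually_compose_filterlim[OF ev2 sh(1)] by (rule eventually_mono) simp
  moreover have "\<forall>\<^sub>F x in at_top. f' x \<le> f (x + 1) - f x"
    using ev2 by (rule eventually_mono) simp
  ultimately show ?thesis by (rule tendsto_sandwich[rotated 2])
qed

section \<open>Tail integrals of functions dominated by a decaying exponential\<close>

lemma exp_dominated_tail:
  fixes f :: "real \<Rightarrow> real"
  assumes "continuous_on {c..} f" and bnd: "\<And>x. x \<ge> c \<Longrightarrow> \<bar>f x\<bar> \<le> C * exp (- x)" and "c \<le> s"
  shows "f integrable_on {s..}" and "\<bar>integral {s..} f\<bar> \<le> C * exp (- s)"
proof -
  have *: "((\<lambda>x. C * exp (- 1 * x)) has_integral C * (exp (- 1 * s) / 1)) {s..}"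
    by (intro has_integral_mult_right has_integral_exp_minus_to_infinity) simp
  show int: "f integrable_on {s..}"
  proof (rule measurable_bounded_by_integrable_imp_integrable)
    show "f \<in> borel_measurable (lebesgue_on {s..})"
      using assms by (intro continuous_imp_measurable_on_sets_lebesgue) (auto intro: continuous_on_subset)
    show "(\<lambda>x. C * exp (- 1 * x)) integrable_on {s..}" using * by blast
  qed (use assms in auto)
  have "norm (integral {s..} f) \<le> integral {s..} (\<lambda>x. C * exp (- 1 * x))"
    using int * bnd \<open>c \<le> s\<close> by (intro integral_norm_bound_integral) auto
  also have "\<dots> = C * exp (- s)" using integral_unique[OF *] by simp
  finally show "\<bar>integral {s..} f\<bar> \<le> C * exp (- s)" by simp
qed

lemma exp_dominated_split:
  fixes f :: "real \<Rightarrow> real"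
  assumes cont: "continuous_on {c..} f" and bnd: "\<And>x. x \<ge> c \<Longrightarrow> \<bar>f x\<bar> \<le> C * exp (- x)" and "c \<le> t"
  shows "integral {c..} f = integral {c..t} f + integral {t..} f"
proof -
  have "(f has_integral (integral {c..t} f + integral {t..} f)) ({c..t} \<union> {t..})"
  proof (rule has_integral_Un)
    show "(f has_integral integral {c..t} f) {c..t}"
      by (intro integrable_integral integrable_continuous_real continuous_on_subset[OF cont]) auto
    show "(f has_integral integral {t..} f) {t..}"
      by (intro integrable_integral exp_dominated_tail(1)[OF cont bnd \<open>c \<le> t\<close>])
    have "{c..t} \<inter> {t..} = {t}" using \<open>c \<le> t\<close> by auto
    then show "negligible ({c..t} \<inter> {t..})" by simp
  qed
  moreover have "{c..t} \<union> {t..} = {c..}" using \<open>c \<le> t\<close> by auto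
  ultimately show ?thesis by (simp add: integral_unique)
qed

text \<open>Near \<open>s\<close> the tail is the constant \<open>integral {c..} f\<close> minus an
  integral over a compact interval, so the ordinary fundamental theorem applies.\<close>

lemma exp_dominated_tail_deriv:
  fixes f :: "real \<Rightarrow> real"
  assumes cont: "continuous_on {c..} f" and bnd: "\<And>x. x \<ge> c \<Longrightarrow> \<bar>f x\<bar> \<le> C * exp (- x)" and "c < s"
  shows "((\<lambda>s. integral {s..} f) has_real_derivative - f s) (at s)"
proof -
  have "((\<lambda>t. integral {c..t} f) has_real_derivative f s) (at s within {c..s+1})"
    by (rule integral_has_real_derivative) (use \<open>c < s\<close> in \<open>auto intro: continuous_on_subset[OF cont]\<close>)
  moreover have "at s within {c..s+1} = at s"
    using \<open>c < s\<close> by (intro at_within_interior) auto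
  ultimately have "((\<lambda>t. integral {c..} f - integral {c..t} f) has_real_derivative - f s) (at s)"
    by (auto intro!: derivative_eq_intros)
  then show ?thesis
  proof (rule has_field_derivative_transform_within_open[where S = "{c<..}"])
    show "integral {c..} f - integral {c..t} f = integral {t..} f" if "t \<in> {c<..}" for t
      using exp_dominated_split[OF cont bnd, of t] that by simp
  qed (use \<open>c < s\<close> in auto)
qed

lemma exp_dominated_tail_tendsto_0:
  fixes f :: "real \<Rightarrow> real"
  assumes "continuous_on {c..} f" and "\<And>x. x \<ge> c \<Longrightarrow> \<bar>f x\<bar> \<le> C * exp (- x)"
  shows "((\<lambda>s. integral {s..} f) \<longlongrightarrow> 0) at_top"
proof (rule Lim_null_comparison)
  show "\<forall>\<^sub>F s in at_top. norm (integral {s..} f) \<le> C * exp (- s)"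
    using exp_dominated_tail(2)[OF assms] by (auto simp: eventually_at_top_linorder)
  show "((\<lambda>s. C * exp (- s)) \<longlongrightarrow> 0) at_top" by real_asymp
qed

lemma exp_dominated_integral_tendsto:
  fixes f :: "real \<Rightarrow> real"
  assumes "continuous_on {c..} f" and "\<And>x. x \<ge> c \<Longrightarrow> \<bar>f x\<bar> \<le> C * exp (- x)"
  shows "((\<lambda>t. integral {c..t} f) \<longlongrightarrow> integral {c..} f) at_top"
proof (rule Lim_transform_eventually)
  show "((\<lambda>t. integral {c..} f - integral {t..} f) \<longlongrightarrow> integral {c..} f) at_top"
    using tendsto_diff[OF tendsto_const exp_dominated_tail_tendsto_0[OF assms]] by simp
  show "\<forall>\<^sub>F t in at_top. integral {c..} f - integral {t..} f = integral {c..t} f"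
    unfolding eventually_at_top_linorder
    using exp_dominated_split[OF assms] by (intro exI[of _ c] allI impI) simp
qed

lemma exp_dominated_FTC:
  fixes f F :: "real \<Rightarrow> real"
  assumes "continuous_on {c..} f" and "\<And>x. x \<ge> c \<Longrightarrow> \<bar>f x\<bar> \<le> C * exp (- x)"
    and F: "\<And>x. x \<ge> c \<Longrightarrow> (F has_real_derivative f x) (at x)"
    and lim: "(F \<longlongrightarrow> L) at_top"
  shows "integral {c..} f = L - F c"
proof (rule tendsto_unique)
  show "((\<lambda>t. integral {c..t} f) \<longlongrightarrow> integral {c..} f) at_top"
    by (rule exp_dominated_integral_tendsto[OF assms(1,2)])
  have "integral {c..t} f = F t - F c" if "t \<ge> c" for t
    by (intro integral_unique fundamental_theorem_of_calculus that)
      (auto intro!: has_field_derivative_at_within F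
         simp: has_real_derivative_iff_has_vector_derivative[symmetric])
  then have "\<forall>\<^sub>F t in at_top. F t - F c = integral {c..t} f"
    unfolding eventually_at_top_linorder by (intro exI[of _ c]) simp
  moreover have "((\<lambda>t. F t - F c) \<longlongrightarrow> L - F c) at_top"
    by (intro tendsto_intros lim)
  ultimately show "((\<lambda>t. integral {c..t} f) \<longlongrightarrow> L - F c) at_top"
    by (rule Lim_transform_eventually[rotated])
qed simp

section \<open>Moments of Gaussians\<close>

text \<open>The bounded weight \<open>t\<close> will be constant or an oscillating factor left over
  from the Airy integrand. The argument \<open>k\<close> comes last so that
  \<open>gauss_moment t n\<close> is a function that can be differentiated in \<open>k\<close>,
  which raises \<open>n\<close> by 2.\<close>

definition gauss_moment :: "(real \<Rightarrow> real) \<Rightarrow> nat \<Rightarrow> real \<Rightarrow> real" where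
  "gauss_moment t n k = integral {0..} (\<lambda>y. y ^ n * exp (- k * y\<^sup>2) * t y)"

lemma power_le_fact_mult_exp:
  fixes y :: real
  assumes "y \<ge> 0" shows "y ^ n \<le> fact n * exp y"
proof -
  have "(\<Sum>m\<in>{n}. y ^ m /\<^sub>R fact m) \<le> exp y"
    using assms unfolding exp_def
    by (intro sum_le_suminf summable_exp_generic) auto
  then show ?thesis by (simp add: field_simps)
qed

lemma gauss_dominated:
  fixes k y :: real
  assumes "k > 0" "y \<ge> 0" "\<bar>c\<bar> \<le> 1"
  shows "\<bar>y ^ n * exp (- k * y\<^sup>2) * c\<bar> \<le> fact n * exp (1 / k) * exp (- y)"
proof -
  \<comment> \<open>Completing the square gives \<open>2 y - k y^2 <= 1 / k\<close>: the Gaussian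
    pays for the \<open>exp y\<close> that bounds the power and still leaves
    \<open>exp (- y)\<close>.\<close>
  have "0 \<le> (k * y - 1)\<^sup>2 / k" using \<open>k > 0\<close> by simp
  also have "\<dots> = k * y\<^sup>2 - 2 * y + 1 / k"
    using \<open>k > 0\<close> by (simp add: field_simps power2_eq_square)
  finally have "y + (- k * y\<^sup>2) \<le> 1 / k + (- y)" by simp
  then have *: "exp y * exp (- k * y\<^sup>2) \<le> exp (1 / k) * exp (- y)"
    by (simp only: exp_add[symmetric] exp_le_cancel_iff)
  have "\<bar>y ^ n * exp (- k * y\<^sup>2) * c\<bar> = y ^ n * exp (- k * y\<^sup>2) * \<bar>c\<bar>"
    using assms by (simp add: abs_mult)
  also have "\<dots> \<le> (fact n * exp y) * exp (- k * y\<^sup>2) * 1"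
    using assms by (intro mult_mono power_le_fact_mult_exp) auto
  also have "\<dots> \<le> fact n * (exp (1 / k) * exp (- y))"
    using * by simp
  finally show ?thesis by (simp add: mult_ac)
qed

lemma gauss_moment_has_integral:
  fixes t :: "real \<Rightarrow> real"
  assumes "continuous_on {0..} t" and "\<And>y. \<bar>t y\<bar> \<le> 1" and "k > 0"
  shows "((\<lambda>y. y ^ n * exp (- k * y\<^sup>2) * t y) has_integral gauss_moment t n k) {0..}"
  unfolding gauss_moment_def
proof (intro integrable_integral exp_dominated_tail(1)[of 0 _ "fact n * exp (1 / k)"])
  show "\<bar>y ^ n * exp (- k * y\<^sup>2) * t y\<bar> \<le> fact n * exp (1 / k) * exp (- y)" if "y \<ge> 0" for y
    by (rule gauss_dominated[OF assms(3) that assms(2)])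
qed (auto intro!: continuous_intros assms(1))

lemma gauss_moment_integral_tendsto:
  fixes t :: "real \<Rightarrow> real"
  assumes "continuous_on {0..} t" and "\<And>y. \<bar>t y\<bar> \<le> 1" and "k > 0"
  shows "((\<lambda>b. integral {0..b} (\<lambda>y. y ^ n * exp (- k * y\<^sup>2) * t y)) \<longlongrightarrow> gauss_moment t n k) at_top"
  unfolding gauss_moment_def
proof (rule exp_dominated_integral_tendsto[of 0 _ "fact n * exp (1 / k)"])
  show "\<bar>y ^ n * exp (- k * y\<^sup>2) * t y\<bar> \<le> fact n * exp (1 / k) * exp (- y)" if "y \<ge> 0" for y
    by (rule gauss_dominated[OF assms(3) that assms(2)])
qed (auto intro!: continuous_intros assms(1))

context
  fixes t :: "real \<Rightarrow> real"
  assumes cont: "continuous_on {0..} t" and bnd: "\<And>y. \<bar>t y\<bar> \<le> 1"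
begin

text \<open>An explicit second-order bound that justifies differentiation under the integral sign.
  The restriction on \<open>h\<close> leaves half of the Gaussian, so the bounding moment is finite
  and independent of \<open>h\<close>.\<close>

lemma gauss_moment_remainder:
  assumes k: "k > 0" and h: "\<bar>h\<bar> \<le> k / 2"
  shows "\<bar>gauss_moment t n (k + h) - gauss_moment t n k + h * gauss_moment t (n + 2) k\<bar>
     \<le> h\<^sup>2 * gauss_moment (\<lambda>_. 1) (n + 4) (k / 2)"
proof -
  have "k + h > 0" using k h by linarith
  let ?D = "\<lambda>y. y ^ n * exp (- (k + h) * y\<^sup>2) * t y - y ^ n * exp (- k * y\<^sup>2) * t y
      + h * (y ^ (n + 2) * exp (- k * y\<^sup>2) * t y)"
  have int1: "((\<lambda>y. h\<^sup>2 * (y ^ (n + 4) * exp (- (k / 2) * y\<^sup>2) * 1)) has_integral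
      h\<^sup>2 * gauss_moment (\<lambda>_. 1) (n + 4) (k / 2)) {0..}"
    by (intro has_integral_mult_right gauss_moment_has_integral) (use k in auto)
  have int2: "(?D has_integral
      (gauss_moment t n (k + h) - gauss_moment t n k + h * gauss_moment t (n + 2) k)) {0..}"
    by (intro has_integral_add has_integral_diff has_integral_mult_right
        gauss_moment_has_integral cont bnd k \<open>k + h > 0\<close>)
  have "\<bar>gauss_moment t n (k + h) - gauss_moment t n k + h * gauss_moment t (n + 2) k\<bar> = norm (integral {0..} ?D)"
    using integral_unique[OF int2] by simp
  also have "\<dots> \<le> integral {0..} (\<lambda>y. h\<^sup>2 * (y ^ (n + 4) * exp (- (k / 2) * y\<^sup>2) * 1))"
  proof (rule integral_norm_bound_integral)
    fix y :: real assume "y \<in> {0..}"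
    then have "y \<ge> 0" by simp
    \<comment> \<open>Taylor expansion with Lagrange remainder; \<open>|h| <= k / 2\<close> ensures
      that \<open>exp u\<close> consumes at most half of the Gaussian exponent.\<close>
    obtain u where u: "\<bar>u\<bar> \<le> \<bar>- h * y\<^sup>2\<bar>"
      "exp (- h * y\<^sup>2) = (\<Sum>m<2. (- h * y\<^sup>2) ^ m / fact m) + exp u / fact 2 * (- h * y\<^sup>2) ^ 2"
      using Maclaurin_exp_le[of "- h * y\<^sup>2" 2] by blast
    have e: "exp (- h * y\<^sup>2) - 1 + h * y\<^sup>2 = exp u / 2 * (h\<^sup>2 * y ^ 4)"
      using u(2) by (simp add: numeral_2_eq_2) (simp add: power2_eq_square eval_nat_numeral)
    have "u \<le> \<bar>h\<bar> * y\<^sup>2" using u(1) by (simp add: abs_mult)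
    also have "\<dots> \<le> k / 2 * y\<^sup>2" using h by (intro mult_right_mono) auto
    finally have "exp u * exp (- k * y\<^sup>2) \<le> exp (- (k / 2) * y\<^sup>2)"
      by (simp add: exp_add[symmetric])
    have "norm (y ^ n * exp (- (k + h) * y\<^sup>2) * t y - y ^ n * exp (- k * y\<^sup>2) * t y
      + h * (y ^ (n + 2) * exp (- k * y\<^sup>2) * t y)) =
      \<bar>y ^ n * exp (- k * y\<^sup>2) * t y * (exp (- h * y\<^sup>2) - 1 + h * y\<^sup>2)\<bar>"
      by (simp add: algebra_simps exp_add[symmetric] power_add power2_eq_square)
    also have "\<dots> = y ^ n * exp (- k * y\<^sup>2) * \<bar>t y\<bar> * (exp u / 2 * (h\<^sup>2 * y ^ 4))"
      unfolding e using \<open>y \<ge> 0\<close> by (simp add: abs_mult)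
    also have "\<dots> = (exp u * exp (- k * y\<^sup>2)) * (\<bar>t y\<bar> / 2) * (h\<^sup>2 * y ^ (n + 4))"
      by (simp add: power_add)
    also have "\<dots> \<le> exp (- (k / 2) * y\<^sup>2) * 1 * (h\<^sup>2 * y ^ (n + 4))"
      using \<open>y \<ge> 0\<close> bnd[of y] \<open>exp u * exp (- k * y\<^sup>2) \<le> _\<close> by (intro mult_mono) auto
    finally show "norm (y ^ n * exp (- (k + h) * y\<^sup>2) * t y - y ^ n * exp (- k * y\<^sup>2) * t y
      + h * (y ^ (n + 2) * exp (- k * y\<^sup>2) * t y)) \<le> h\<^sup>2 * (y ^ (n + 4) * exp (- (k / 2) * y\<^sup>2) * 1)"
      by (simp add: mult_ac)
  qed (use int1 int2 in blast)+
  also have "\<dots> = h\<^sup>2 * gauss_moment (\<lambda>_. 1) (n + 4) (k / 2)"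
    by (rule integral_unique[OF int1])
  finally show ?thesis .
qed

lemma has_real_derivative_gauss_moment:
  assumes k: "k > 0"
  shows "(gauss_moment t n has_real_derivative - gauss_moment t (n + 2) k) (at k)"
  unfolding DERIV_def
proof (rule LIM_zero_cancel, rule Lim_null_comparison)
  let ?M = "gauss_moment (\<lambda>_. 1) (n + 4) (k / 2)"
  show "\<forall>\<^sub>F h in at 0. norm ((gauss_moment t n (k + h) - gauss_moment t n k) / h - - gauss_moment t (n + 2) k)
      \<le> \<bar>h\<bar> * ?M"
    unfolding eventually_at
  proof (intro exI[of _ "k / 2"] conjI ballI impI)
    fix h :: real assume h: "h \<noteq> 0 \<and> dist h 0 < k / 2"
    then have "\<bar>(gauss_moment t n (k + h) - gauss_moment t n k) / h - - gauss_moment t (n + 2) k\<bar> =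
      \<bar>gauss_moment t n (k + h) - gauss_moment t n k + h * gauss_moment t (n + 2) k\<bar> / \<bar>h\<bar>"
      by (simp add: abs_divide[symmetric] add_divide_distrib)
    also have "\<dots> \<le> (h\<^sup>2 * ?M) / \<bar>h\<bar>"
      by (intro divide_right_mono gauss_moment_remainder k) (use h in auto)
    also have "\<dots> = \<bar>h\<bar> * ?M"
    proof -
      have "h\<^sup>2 = \<bar>h\<bar> * \<bar>h\<bar>" by (simp add: power2_eq_square)
      then show ?thesis using h by (simp add: field_simps)
    qed
    finally show "norm ((gauss_moment t n (k + h) - gauss_moment t n k) / h - - gauss_moment t (n + 2) k)
      \<le> \<bar>h\<bar> * ?M" by simp
  qed (use k in auto)
  show "((\<lambda>h. \<bar>h\<bar> * ?M) \<longlongrightarrow> 0) (at 0)"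
    by (rule tendsto_eq_intros refl | simp)+
qed

text \<open>Integrate the derivative of \<open>y^m exp (- k y^2) t y\<close>. The factor
  \<open>y^2\<close> in the derivative of \<open>t\<close> is the inner derivative of
  \<open>y^3 / 3\<close>. The boundary term survives only for \<open>m = 0\<close>, where
  \<open>0 ^ 0 = 1\<close>, while the factor \<open>real m\<close> then removes the truncated index
  \<open>m - 1\<close>.\<close>

lemma gauss_moment_parts:
  assumes k: "k > 0"
    and deriv: "\<And>y. y \<ge> 0 \<Longrightarrow> (t has_real_derivative y\<^sup>2 * u y) (at y)"
    and contu: "continuous_on {0..} u" and bndu: "\<And>y. \<bar>u y\<bar> \<le> 1"
  shows "real m * gauss_moment t (m - 1) k - 2 * k * gauss_moment t (m + 1) k + gauss_moment u (m + 2) k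
    = - (0 ^ m * t 0)"
proof -
  define f where "f = (\<lambda>y. real m * (y ^ (m - 1) * exp (- k * y\<^sup>2) * t y)
      - 2 * k * (y ^ (m + 1) * exp (- k * y\<^sup>2) * t y) + y ^ (m + 2) * exp (- k * y\<^sup>2) * u y)"
  define B where "B = (\<lambda>n. fact n * exp (1 / k))"
  have "integral {0..} f = 0 - (0 ^ m * exp (- k * 0\<^sup>2) * t 0)"
  proof (rule exp_dominated_FTC)
    show "continuous_on {0..} f"
      unfolding f_def by (intro continuous_intros cont contu)
    show "\<bar>f y\<bar> \<le> (real m * B (m - 1) + 2 * k * B (m + 1) + B (m + 2)) * exp (- y)" if "y \<ge> 0" for y
    proof -
      have "\<bar>f y\<bar> \<le> real m * \<bar>y ^ (m - 1) * exp (- k * y\<^sup>2) * t y\<bar>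
        + 2 * k * \<bar>y ^ (m + 1) * exp (- k * y\<^sup>2) * t y\<bar> + \<bar>y ^ (m + 2) * exp (- k * y\<^sup>2) * u y\<bar>"
        unfolding f_def using k
        by (intro order_trans[OF abs_triangle_ineq] add_mono order_trans[OF abs_triangle_ineq4])
          (simp_all add: abs_mult)
      also have "\<dots> \<le> real m * (B (m - 1) * exp (- y)) + 2 * k * (B (m + 1) * exp (- y)) + B (m + 2) * exp (- y)"
        unfolding B_def using k by (intro add_mono mult_left_mono gauss_dominated that bnd bndu) auto
      finally show ?thesis by (simp add: algebra_simps)
    qed
    show "((\<lambda>y. y ^ m * exp (- k * y\<^sup>2) * t y) has_real_derivative f y) (at y)" if "y \<ge> 0" for y
      unfolding f_def using that
      by (auto intro!: derivative_eq_intros deriv) (simp add: power_add power2_eq_square algebra_simps)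
    show "((\<lambda>y. y ^ m * exp (- k * y\<^sup>2) * t y) \<longlongrightarrow> 0) at_top"
    proof (rule Lim_null_comparison)
      show "\<forall>\<^sub>F y in at_top. norm (y ^ m * exp (- k * y\<^sup>2) * t y) \<le> B m * exp (- y)"
        unfolding eventually_at_top_linorder B_def
        by (intro exI[of _ 0] allI impI) (simp only: real_norm_def gauss_dominated[OF k _ bnd])
      show "((\<lambda>y. B m * exp (- y)) \<longlongrightarrow> 0) at_top" by real_asymp
    qed
  qed
  moreover have "(f has_integral
     (real m * gauss_moment t (m - 1) k - 2 * k * gauss_moment t (m + 1) k + gauss_moment u (m + 2) k)) {0..}"
    unfolding f_def
    by (intro has_integral_add has_integral_diff has_integral_mult_right
        gauss_moment_has_integral cont bnd contu bndu k)
  ultimately show ?thesis by (simp add: integral_unique)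
qed

end

section \<open>The Airy function on the positive axis\<close>

lemma gauss_moment_0:
  assumes "k > 0" shows "gauss_moment (\<lambda>_. 1) 0 k = sqrt pi / (2 * sqrt k)"
proof -
  have "has_bochner_integral lborel
      (\<lambda>x. indicator {0..} (0 + sqrt k * x) *\<^sub>R exp (- (0 + sqrt k * x)\<^sup>2)) (sqrt pi / 2 /\<^sub>R \<bar>sqrt k\<bar>)"
    using gaussian_moment_0 assms
    by (subst (asm) lborel_has_bochner_integral_real_affine_iff[of "sqrt k" _ _ 0]) auto
  also have "(\<lambda>x. indicator {0..} (0 + sqrt k * x) *\<^sub>R exp (- (0 + sqrt k * x)\<^sup>2)) =
      (\<lambda>x. indicator {0..} x *\<^sub>R exp (- k * x\<^sup>2))"
    using assms by (auto simp: fun_eq_iff indicator_def power_mult_distrib zero_le_mult_iff)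
  finally have "has_bochner_integral lborel (\<lambda>x. indicator {0..} x *\<^sub>R exp (- k * x\<^sup>2))
      (sqrt pi / 2 /\<^sub>R \<bar>sqrt k\<bar>)" .
  then show ?thesis
    unfolding has_bochner_integral_iff gauss_moment_def
    using set_borel_integral_eq_integral(2)[of "{0..}" "\<lambda>x. exp (- k * x\<^sup>2)"] assms
    by (simp add: set_integrable_def set_lebesgue_integral_def field_simps)
qed

text \<open>Integration by parts with constant weight for \<open>m = 1, 3, 5\<close> gives the
  factors \<open>1 * 3 * 5\<close> over \<open>(2 k)^3\<close>. The sixth moment measures the error
  of replacing \<open>cos (y^3 / 3)\<close> by 1.\<close>

lemma gauss_moment_6:
  assumes "k > 0"
  shows "gauss_moment (\<lambda>_. 1) 6 k = 15 / (8 * k ^ 3) * gauss_moment (\<lambda>_. 1) 0 k"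
proof -
  have "real m * gauss_moment (\<lambda>_. 1) (m - 1) k - 2 * k * gauss_moment (\<lambda>_. 1) (m + 1) k
      + gauss_moment (\<lambda>_. 0) (m + 2) k = - (0 ^ m * 1)" for m
    by (rule gauss_moment_parts) (use assms in auto)
  note parts = this[unfolded gauss_moment_def[of "\<lambda>_. 0"]]
  have "gauss_moment (\<lambda>_. 1) 0 k = 2 * k * gauss_moment (\<lambda>_. 1) 2 k"
    using parts[of 1] by (simp add: numeral_2_eq_2)
  moreover have "3 * gauss_moment (\<lambda>_. 1) 2 k = 2 * k * gauss_moment (\<lambda>_. 1) 4 k"
    using parts[of 3] by simp
  moreover have "5 * gauss_moment (\<lambda>_. 1) 4 k = 2 * k * gauss_moment (\<lambda>_. 1) 6 k"
    using parts[of 5] by simp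
  ultimately have "15 * gauss_moment (\<lambda>_. 1) 0 k = 8 * k ^ 3 * gauss_moment (\<lambda>_. 1) 6 k"
    by algebra
  then show ?thesis using assms by (simp add: field_simps)
qed

text \<open>After the contour shift \<open>Ai x\<close> becomes an explicit exponential times
  \<open>airy_cos 0 (sqrt x)\<close>. Derivatives in \<open>k\<close> lead to higher
  \<open>n\<close>, and integration by parts couples these cosine moments to the sine moments
  defined next.\<close>

definition airy_cos :: "nat \<Rightarrow> real \<Rightarrow> real" where
  "airy_cos = gauss_moment (\<lambda>y. cos (y ^ 3 / 3))"

definition airy_sin :: "nat \<Rightarrow> real \<Rightarrow> real" where
  "airy_sin = gauss_moment (\<lambda>y. sin (y ^ 3 / 3))"

lemma airy_cos_deriv:
  "k > 0 \<Longrightarrow> (airy_cos n has_real_derivative - airy_cos (n + 2) k) (at k)"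
  unfolding airy_cos_def by (rule has_real_derivative_gauss_moment) (auto intro!: continuous_intros)

lemma airy_cos_parts:
  assumes "k > 0"
  shows "real m * airy_cos (m - 1) k - 2 * k * airy_cos (m + 1) k - airy_sin (m + 2) k = - (0 ^ m)"
proof -
  have "real m * gauss_moment (\<lambda>y. cos (y ^ 3 / 3)) (m - 1) k - 2 * k * gauss_moment (\<lambda>y. cos (y ^ 3 / 3)) (m + 1) k
      + gauss_moment (\<lambda>y. - sin (y ^ 3 / 3)) (m + 2) k = - (0 ^ m * cos (0 ^ 3 / 3))"
    by (rule gauss_moment_parts)
      (use assms in \<open>auto intro!: continuous_intros derivative_eq_intros simp: power2_eq_square\<close>)
  moreover have "gauss_moment (\<lambda>y. - sin (y ^ 3 / 3)) n k = - gauss_moment (\<lambda>y. sin (y ^ 3 / 3)) n k" for n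
    by (simp add: gauss_moment_def)
  ultimately show ?thesis
    unfolding airy_cos_def airy_sin_def by simp
qed

lemma airy_sin_parts:
  assumes "k > 0"
  shows "real m * airy_sin (m - 1) k - 2 * k * airy_sin (m + 1) k + airy_cos (m + 2) k = 0"
proof -
  have "real m * gauss_moment (\<lambda>y. sin (y ^ 3 / 3)) (m - 1) k - 2 * k * gauss_moment (\<lambda>y. sin (y ^ 3 / 3)) (m + 1) k
      + gauss_moment (\<lambda>y. cos (y ^ 3 / 3)) (m + 2) k = - (0 ^ m * sin (0 ^ 3 / 3))"
    by (rule gauss_moment_parts)
      (use assms in \<open>auto intro!: continuous_intros derivative_eq_intros simp: power2_eq_square\<close>)
  then show ?thesis unfolding airy_cos_def airy_sin_def by simp
qed

text \<open>The Airy equation at the level of moments, obtained by eliminating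
  \<open>airy_sin 1\<close> and \<open>airy_sin 3\<close> from three integrations by parts.\<close>

lemma airy_cos_4:
  assumes "k > 0"
  shows "airy_cos 4 k = 2 * k * airy_cos 0 k - (4 * k\<^sup>2 + 1 / k) * airy_cos 2 k"
proof -
  have "2 * airy_sin 1 k - 2 * k * airy_sin 3 k + airy_cos 4 k = 0"
    using airy_sin_parts[OF assms, of 2] by (simp add: eval_nat_numeral)
  moreover have "airy_cos 0 k - 2 * k * airy_cos 2 k - airy_sin 3 k = 0"
    using airy_cos_parts[OF assms, of 1] by (simp add: eval_nat_numeral)
  moreover have "airy_cos 2 k = 2 * k * airy_sin 1 k"
    using airy_sin_parts[OF assms, of 0] by (simp add: eval_nat_numeral)
  moreover from this have "1 / k * airy_cos 2 k = 2 * airy_sin 1 k"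
    using assms by simp
  ultimately show ?thesis
    by algebra
qed

lemma one_minus_cos_le: "1 - cos x \<le> x\<^sup>2 / 2" for x :: real
proof -
  have "1 - cos x = 2 * (sin (x / 2))\<^sup>2"
    using cos_double_sin[of "x / 2"] by simp
  also have "\<dots> \<le> 2 * (x / 2)\<^sup>2"
    using abs_sin_x_le_abs_x[of "x / 2"] by (simp only: abs_le_square_iff mult_le_cancel_left_pos)
  finally show "1 - cos x \<le> x\<^sup>2 / 2" by (simp add: power2_eq_square)
qed

text \<open>Integrate \<open>1 - y^6 / 18 <= cos (y^3 / 3) <= 1\<close> against the Gaussian; the
  constant is \<open>15 / (8 * 18) = 15 / 144\<close>.\<close>

lemma airy_cos_0_bounds:
  assumes "k > 0"
  shows "airy_cos 0 k \<le> sqrt pi / (2 * sqrt k)"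
    and "(1 - 15 / (144 * k ^ 3)) * (sqrt pi / (2 * sqrt k)) \<le> airy_cos 0 k"
proof -
  let ?c = "\<lambda>y::real. cos (y ^ 3 / 3)"
  have 1: "((\<lambda>y. y ^ n * exp (- k * y\<^sup>2) * 1) has_integral gauss_moment (\<lambda>_. 1) n k) {0..}" for n
    by (rule gauss_moment_has_integral) (use assms in auto)
  have c: "((\<lambda>y. y ^ 0 * exp (- k * y\<^sup>2) * ?c y) has_integral airy_cos 0 k) {0..}"
    unfolding airy_cos_def
    by (rule gauss_moment_has_integral) (use assms in \<open>auto intro!: continuous_intros\<close>)
  have "airy_cos 0 k \<le> gauss_moment (\<lambda>_. 1) 0 k"
    by (rule has_integral_le[OF c 1]) auto
  then show "airy_cos 0 k \<le> sqrt pi / (2 * sqrt k)"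
    using gauss_moment_0[OF assms] by simp
  have "gauss_moment (\<lambda>_. 1) 0 k - 1 / 18 * gauss_moment (\<lambda>_. 1) 6 k \<le> airy_cos 0 k"
  proof (rule has_integral_le[OF has_integral_diff[OF 1 has_integral_mult_right[OF 1]] c])
    fix y :: real assume "y \<in> {0..}"
    have "1 - (y ^ 3 / 3)\<^sup>2 / 2 \<le> ?c y"
      using one_minus_cos_le[of "y ^ 3 / 3"] by linarith
    then have "exp (- k * y\<^sup>2) * (1 - (y ^ 3 / 3)\<^sup>2 / 2) \<le> exp (- k * y\<^sup>2) * ?c y"
      by (intro mult_left_mono) auto
    then show "y ^ 0 * exp (- k * y\<^sup>2) * 1 - 1 / 18 * (y ^ 6 * exp (- k * y\<^sup>2) * 1)
        \<le> y ^ 0 * exp (- k * y\<^sup>2) * ?c y"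
      by (simp add: field_simps eval_nat_numeral)
  qed
  then show "(1 - 15 / (144 * k ^ 3)) * (sqrt pi / (2 * sqrt k)) \<le> airy_cos 0 k"
  proof -
    have "(1 - 15 / (144 * k ^ 3)) * g = g - 1 / 18 * (15 / (8 * k ^ 3) * g)" for g :: real
      using assms by (simp add: field_simps)
    then show ?thesis
      using \<open>gauss_moment (\<lambda>_. 1) 0 k - 1 / 18 * gauss_moment (\<lambda>_. 1) 6 k \<le> airy_cos 0 k\<close>
      unfolding gauss_moment_6[OF assms] gauss_moment_0[OF assms] by (simp only:)
  qed
qed

text \<open>
  The contour \<open>[0, b]\<close> is moved up to the saddle point height \<open>k = sqrt x\<close>, where the integrand becomes
  Gaussian.  The left edge of the rectangle contributes only to the imaginary part, and the right edge
  vanishes as \<open>b \<longlongrightarrow> \<infinity>\<close>.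
\<close>

lemma airy_integral_tendsto:
  assumes "k > 0"
  shows "((\<lambda>b. integral {0..b} (\<lambda>t. cos (t ^ 3 / 3 + k\<^sup>2 * t))) \<longlongrightarrow>
           exp (- (2 / 3) * k ^ 3) * airy_cos 0 k) at_top"
proof -
  define F where "F = (\<lambda>z::complex. exp (\<i> * (z ^ 3 / 3 + of_real (k\<^sup>2) * z)))"
  \<comment> \<open>The integrand is entire, so it has a primitive. Integrals along the edges of the
    rectangle become differences of \<open>Re P\<close> at its corners, and no contour integral is
    needed.\<close>
  obtain P where P: "\<And>z. (P has_field_derivative F z) (at z)"
  proof (rule holomorphic_convex_primitive'[of UNIV F])
    show "F holomorphic_on UNIV" unfolding F_def by (intro holomorphic_intros) auto
  qed auto
  have ReP: "((\<lambda>t. Re (P (g t))) has_real_derivative Re (d * F (g t))) (at t)"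
    if "(g has_vector_derivative d) (at t)" for g d t
    using bounded_linear.has_vector_derivative[OF bounded_linear_Re field_vector_diff_chain_at[OF that P]]
    by (simp add: has_real_derivative_iff_has_vector_derivative o_def)
  have FTC: "integral {0..b} h = H b - H 0"
    if "b \<ge> 0" "\<And>t. (H has_real_derivative h t) (at t)" for b and h H :: "real \<Rightarrow> real"
    by (intro integral_unique fundamental_theorem_of_calculus that)
      (auto intro!: has_field_derivative_at_within that
         simp: has_real_derivative_iff_has_vector_derivative[symmetric])
  have F_Complex: "F (Complex a h) = exp (Complex (h ^ 3 / 3 - a\<^sup>2 * h - k\<^sup>2 * h) (a ^ 3 / 3 - a * h\<^sup>2 + k\<^sup>2 * a))" for a h
    unfolding F_def
    by (rule arg_cong[of _ _ exp]) (simp add: complex_eq_iff power3_eq_cube power2_eq_square field_simps)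
  define f where "f = (\<lambda>y. y ^ 0 * exp (- k * y\<^sup>2) * cos (y ^ 3 / 3))"
  define E where "E = exp (- (2 / 3) * k ^ 3)"
  have bottom: "integral {0..b} (\<lambda>t. cos (t ^ 3 / 3 + k\<^sup>2 * t)) = Re (P (Complex b 0)) - Re (P (Complex 0 0))"
    if "b \<ge> 0" for b
  proof (rule FTC[OF that])
    fix t :: real
    have "((\<lambda>t. Complex t 0) has_vector_derivative 1) (at t)"
      unfolding complex_of_real_def[symmetric] by (auto intro!: derivative_eq_intros)
    from ReP[OF this] show "((\<lambda>t. Re (P (Complex t 0))) has_real_derivative cos (t ^ 3 / 3 + k\<^sup>2 * t)) (at t)"
      by (simp add: F_Complex Re_exp)
  qed
  have top: "E * integral {0..b} f = Re (P (Complex b k)) - Re (P (Complex 0 k))"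
    if "b \<ge> 0" for b
  proof -
    have "integral {0..b} (\<lambda>y. E * f y) = Re (P (Complex b k)) - Re (P (Complex 0 k))"
    proof (rule FTC[OF that])
      fix t :: real
      have "((\<lambda>t. of_real t + Complex 0 k) has_vector_derivative 1) (at t)"
        by (auto intro!: derivative_eq_intros)
      also have "(\<lambda>t. of_real t + Complex 0 k) = (\<lambda>t. Complex t k)"
        by (simp add: complex_eq_iff fun_eq_iff)
      finally have "((\<lambda>t. Complex t k) has_vector_derivative 1) (at t)" .
      from ReP[OF this] have "((\<lambda>t. Re (P (Complex t k))) has_real_derivative Re (F (Complex t k))) (at t)"
        by (simp only: mult_1_left)
      also have "Re (F (Complex t k)) = E * f t"
      proof -
        \<comment> \<open>At height \<open>k\<close> the linear terms of the phase cancel. This is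
          the saddle point condition, and only the cubic phase remains.\<close>
        have "k ^ 3 / 3 - t\<^sup>2 * k - k\<^sup>2 * k = - (2 / 3) * k ^ 3 + - k * t\<^sup>2"
          by (simp add: power2_eq_square power3_eq_cube)
        moreover have "t ^ 3 / 3 - t * k\<^sup>2 + k\<^sup>2 * t = t ^ 3 / 3" by simp
        ultimately show ?thesis
          unfolding f_def E_def F_Complex Re_exp complex.sel by (simp only: exp_add power_0 mult_1_left mult.assoc)
      qed
      finally show "((\<lambda>t. Re (P (Complex t k))) has_real_derivative E * f t) (at t)" .
    qed
    then show ?thesis by simp
  qed
  have vert: "((\<lambda>h. Complex a h) has_vector_derivative \<i>) (at h)" for a h
  proof -
    have "((\<lambda>h. of_real a + of_real h * \<i>) has_vector_derivative \<i>) (at h)"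
      by (auto intro!: derivative_eq_intros)
    also have "(\<lambda>h. of_real a + of_real h * \<i>) = (\<lambda>h. Complex a h)"
      by (simp add: complex_eq_iff fun_eq_iff)
    finally show ?thesis .
  qed
  have left: "Re (P (Complex 0 k)) = Re (P (Complex 0 0))"
  proof -
    \<comment> \<open>On the imaginary axis \<open>F\<close> is real and the path runs in direction
      \<open>i\<close>, so the real part does not change.\<close>
    have "((\<lambda>h. Re (P (Complex 0 h))) has_real_derivative 0) (at h)" for h
      using ReP[OF vert, of 0 h] by (simp add: F_Complex Im_exp)
    then show ?thesis
      using DERIV_isconst_all[of "\<lambda>h. Re (P (Complex 0 h))" k 0] by blast
  qed
  have right: "\<bar>Re (P (Complex b k)) - Re (P (Complex b 0))\<bar> \<le> 1 / b\<^sup>2" if "b > 0" for b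
  proof -
    have "\<sigma> * (Re (P (Complex b k)) - Re (P (Complex b 0))) \<le> 1 / b\<^sup>2" if "\<bar>\<sigma>\<bar> = 1" for \<sigma> :: real
    proof -
      \<comment> \<open>On the right edge \<open>|F| <= exp (- b^2 h)\<close>, because
        \<open>h^3 / 3 <= k^2 h\<close>. The second summand is an antiderivative of minus this
        bound, so \<open>?H\<close> cannot increase; the sign \<open>\<sigma>\<close> gives both
        directions of the absolute value.\<close>
      let ?H = "\<lambda>h. \<sigma> * Re (P (Complex b h)) + exp (- (b\<^sup>2) * h) / b\<^sup>2"
      have "?H k \<le> ?H 0"
      proof (rule DERIV_nonpos_imp_nonincreasing[where f = ?H])
        fix h assume h: "0 \<le> h" "h \<le> k"
        have "(?H has_real_derivative \<sigma> * Re (\<i> * F (Complex b h)) + - (b\<^sup>2) * exp (- (b\<^sup>2) * h) / b\<^sup>2) (at h)"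
        proof (rule DERIV_add[OF DERIV_cmult[OF ReP[OF vert]]])
          show "((\<lambda>h. exp (- (b\<^sup>2) * h) / b\<^sup>2) has_real_derivative - (b\<^sup>2) * exp (- (b\<^sup>2) * h) / b\<^sup>2) (at h)"
            by (rule DERIV_cdivide) (auto intro!: derivative_eq_intros)
        qed
        moreover have "\<sigma> * Re (\<i> * F (Complex b h)) + - (b\<^sup>2) * exp (- (b\<^sup>2) * h) / b\<^sup>2 \<le> 0"
        proof -
          have "\<sigma> * Re (\<i> * F (Complex b h)) \<le> \<bar>\<sigma> * Re (\<i> * F (Complex b h))\<bar>" by simp
          also have "\<dots> = \<bar>Re (\<i> * F (Complex b h))\<bar>" using that by (simp add: abs_mult)
          also have "\<dots> \<le> norm (\<i> * F (Complex b h))" by (rule abs_Re_le_cmod)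
          also have "\<dots> = exp (h ^ 3 / 3 - b\<^sup>2 * h - k\<^sup>2 * h)"
            by (simp add: F_Complex norm_mult)
          also have "\<dots> \<le> exp (- (b\<^sup>2) * h)"
          proof -
            have "h ^ 3 / 3 \<le> h ^ 3" using h by simp
            also have "\<dots> = h\<^sup>2 * h" by (simp add: power2_eq_square power3_eq_cube)
            also have "\<dots> \<le> k\<^sup>2 * h" using h by (intro mult_right_mono power_mono) auto
            finally show ?thesis by simp
          qed
          finally show ?thesis using \<open>b > 0\<close> by simp
        qed
        ultimately show "\<exists>y. (?H has_real_derivative y) (at h) \<and> y \<le> 0" by blast
      qed (use \<open>k > 0\<close> in simp)
      moreover have "exp (- (b\<^sup>2) * k) / b\<^sup>2 \<ge> 0" by simp
      ultimately show ?thesis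
        unfolding right_diff_distrib mult_zero_right exp_zero by linarith
    qed
    from this[of 1] this[of "-1"] show ?thesis by (simp add: abs_le_iff)
  qed
  have "((\<lambda>b. E * integral {0..b} f - (Re (P (Complex b k)) - Re (P (Complex b 0)))) \<longlongrightarrow> E * airy_cos 0 k - 0) at_top"
  proof (intro tendsto_intros)
    show "((\<lambda>b. integral {0..b} f) \<longlongrightarrow> airy_cos 0 k) at_top"
      unfolding f_def airy_cos_def
      by (rule gauss_moment_integral_tendsto) (use assms in \<open>auto intro!: continuous_intros\<close>)
    show "((\<lambda>b. Re (P (Complex b k)) - Re (P (Complex b 0))) \<longlongrightarrow> 0) at_top"
    proof (rule Lim_null_comparison)
      show "\<forall>\<^sub>F b in at_top. norm (Re (P (Complex b k)) - Re (P (Complex b 0))) \<le> 1 / b\<^sup>2"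
        using eventually_gt_at_top[of 0] by eventually_elim (simp only: real_norm_def right)
      show "((\<lambda>b. 1 / b\<^sup>2) \<longlongrightarrow> (0::real)) at_top" by real_asymp
    qed
  qed
  moreover have "\<forall>\<^sub>F b in at_top. E * integral {0..b} f - (Re (P (Complex b k)) - Re (P (Complex b 0))) =
      integral {0..b} (\<lambda>t. cos (t ^ 3 / 3 + k\<^sup>2 * t))"
    using eventually_ge_at_top[of 0]
  proof eventually_elim
    case (elim b)
    from bottom[OF elim] top[OF elim] left show ?case by linarith
  qed
  ultimately show ?thesis
    unfolding E_def diff_zero by (rule Lim_transform_eventually)
qed

section \<open>The Airy equation and the leading asymptotics of Ai\<close>

lemma Ai_eq_airy_cos:
  assumes "x > 0" shows "Ai x = exp (- (2 / 3) * sqrt x ^ 3) * airy_cos 0 (sqrt x) / pi"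
  unfolding Ai_def
  using tendsto_Lim[OF _ airy_integral_tendsto[of "sqrt x"]] assms by simp

lemma Ai_has_derivatives:
  assumes "x > 0"
  shows "(Ai has_real_derivative deriv Ai x) (at x)" and "(deriv Ai has_real_derivative x * Ai x) (at x)"
proof -
  define E where "E = (\<lambda>k::real. exp (- (2 / 3) * k ^ 3) / pi)"
  \<comment> \<open>\<open>B\<close> is \<open>Ai'\<close> written in the variable
    \<open>k = sqrt x\<close>. Since \<open>dx = 2 k dk\<close>, every derivative with respect to
    \<open>k\<close> below carries a factor \<open>2 k\<close>.\<close>
  define B where "B = (\<lambda>k. E k * (- k * airy_cos 0 k - airy_cos 2 k / (2 * k)))"
  have E: "(E has_real_derivative - 2 * k\<^sup>2 * E k) (at k)" for k
    unfolding E_def by (auto intro!: derivative_eq_intros)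
  have C0: "(airy_cos 0 has_real_derivative - airy_cos 2 k) (at k)"
    and C2: "(airy_cos 2 has_real_derivative - airy_cos 4 k) (at k)" if "k > 0" for k
    using airy_cos_deriv[OF that, of 0] airy_cos_deriv[OF that, of 2] by (simp_all only: add_0 numeral_plus_numeral semiring_norm)
  have f': "((\<lambda>k. E k * airy_cos 0 k) has_real_derivative 2 * k * B k) (at k)" if "k > 0" for k
    using DERIV_mult[OF E C0[OF that]] by (rule DERIV_cong)
      (use that in \<open>simp add: B_def field_simps power2_eq_square\<close>)
  have B': "(B has_real_derivative 2 * k * (k\<^sup>2 * (E k * airy_cos 0 k))) (at k)" if "k > 0" for k
  proof -
    have lin: "((\<lambda>k. - k) has_real_derivative - 1) (at k)" "((\<lambda>k. 2 * k) has_real_derivative 2) (at k)"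
      by (auto intro!: derivative_eq_intros)
    have "2 * k \<noteq> 0" using that by simp
    from DERIV_mult[OF E DERIV_diff[OF DERIV_mult[OF lin(1) C0[OF that]] DERIV_divide[OF C2[OF that] lin(2) this]]]
    show ?thesis unfolding B_def
      by (rule DERIV_cong) (use that in \<open>simp add: airy_cos_4 field_simps power2_eq_square power3_eq_cube\<close>)
  qed
  have chain: "((\<lambda>x. g (sqrt x)) has_real_derivative d) (at x)"
    if "x > 0" "(g has_real_derivative 2 * sqrt x * d) (at (sqrt x))" for g :: "real \<Rightarrow> real" and d x
    by (rule DERIV_cong[OF DERIV_chain2[OF that(2) DERIV_real_sqrt[OF that(1)]]])
      (use that in \<open>simp add: field_simps\<close>)
  have Ai: "Ai x = E (sqrt x) * airy_cos 0 (sqrt x)" if "x > 0" for x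
    unfolding Ai_eq_airy_cos[OF that] E_def by simp
  have Ai': "(Ai has_real_derivative B (sqrt x)) (at x)" if "x > 0" for x
    by (rule has_field_derivative_transform_within_open[OF chain[OF that f'], of "{0<..}"])
      (use that Ai in auto)
  have A': "deriv Ai x = B (sqrt x)" if "x > 0" for x
    by (rule DERIV_imp_deriv[OF Ai'[OF that]])
  show "(Ai has_real_derivative deriv Ai x) (at x)"
    using Ai'[OF assms] A'[OF assms] by simp
  have "((\<lambda>x. B (sqrt x)) has_real_derivative (sqrt x)\<^sup>2 * (E (sqrt x) * airy_cos 0 (sqrt x))) (at x)"
    by (rule chain[OF assms B']) (use assms in simp)
  then have "((\<lambda>x. B (sqrt x)) has_real_derivative x * Ai x) (at x)"
    using assms Ai[OF assms] by simp
  then show "(deriv Ai has_real_derivative x * Ai x) (at x)"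
    by (rule has_field_derivative_transform_within_open[of _ _ _ "{0<..}"]) (use assms A' in auto)
qed

lemma Ai_asymp:
  "((\<lambda>x. Ai x / (exp (- (2 / 3) * x powr (3 / 2)) * x powr (- 1 / 4) / (2 * sqrt pi))) \<longlongrightarrow> 1) at_top"
proof (rule tendsto_sandwich)
  have eq: "Ai x / (exp (- (2 / 3) * x powr (3 / 2)) * x powr (- 1 / 4) / (2 * sqrt pi)) =
      airy_cos 0 (sqrt x) / (sqrt pi / (2 * sqrt (sqrt x)))" if "x > 0" for x
  proof -
    have "sqrt x ^ 3 = x powr (3 / 2)"
      using that by (simp add: powr_half_sqrt[symmetric] powr_power)
    moreover have "sqrt (sqrt x) * x powr (- 1 / 4) = 1"
      using that by (simp add: powr_half_sqrt[symmetric] powr_powr powr_add[symmetric])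
    ultimately show ?thesis
      using that Ai_eq_airy_cos[OF that] by (simp add: field_simps)
  qed
  show "\<forall>\<^sub>F x in at_top. Ai x / (exp (- (2 / 3) * x powr (3 / 2)) * x powr (- 1 / 4) / (2 * sqrt pi)) \<le> 1"
    using eventually_gt_at_top[of 0]
  proof eventually_elim
    case (elim x)
    then show ?case using airy_cos_0_bounds(1)[of "sqrt x"] by (simp only: eq) (simp add: field_simps)
  qed
  show "\<forall>\<^sub>F x in at_top. 1 - 15 / (144 * sqrt x ^ 3) \<le>
      Ai x / (exp (- (2 / 3) * x powr (3 / 2)) * x powr (- 1 / 4) / (2 * sqrt pi))"
    using eventually_gt_at_top[of 0]
  proof eventually_elim
    case (elim x)
    then have pos: "sqrt pi / (2 * sqrt (sqrt x)) > 0" by simp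
    show ?case using elim airy_cos_0_bounds(2)[of "sqrt x"]
      unfolding eq[OF elim] pos_le_divide_eq[OF pos] by simp
  qed
  show "((\<lambda>x. 1 - 15 / (144 * sqrt x ^ 3)) \<longlongrightarrow> (1::real)) at_top" by real_asymp
qed simp

section \<open>Leading coefficients relative to powers of Ai\<close>

lemma Ai_eventually_pos: "\<forall>\<^sub>F x in at_top. Ai x > 0"
  using order_tendstoD(1)[OF Ai_asymp zero_less_one] eventually_gt_at_top[of 0]
  by eventually_elim (auto simp: zero_less_divide_iff zero_less_mult_iff mult_less_0_iff)

lemma Ai_decay: "((\<lambda>x. Ai x * x powr j * exp x) \<longlongrightarrow> 0) at_top"
proof (rule Lim_transform_eventually)
  let ?G = "\<lambda>x. exp (- (2 / 3) * x powr (3 / 2)) * x powr (- 1 / 4) / (2 * sqrt pi)"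
  have "((\<lambda>x. ?G x * x powr j * exp x) \<longlongrightarrow> 0) at_top" by real_asymp
  from tendsto_mult[OF Ai_asymp this]
  show "((\<lambda>x. Ai x / ?G x * (?G x * x powr j * exp x)) \<longlongrightarrow> 0) at_top" by simp
  show "\<forall>\<^sub>F x in at_top. Ai x / ?G x * (?G x * x powr j * exp x) = Ai x * x powr j * exp x"
    using eventually_gt_at_top[of 0] by eventually_elim simp
qed

lemma Ai_powr_tendsto_0: "((\<lambda>x. Ai x * x powr j) \<longlongrightarrow> 0) at_top"
proof -
  have "((\<lambda>x::real. exp (- x)) \<longlongrightarrow> 0) at_top" by real_asymp
  from tendsto_mult[OF Ai_decay this] show ?thesis
    by (simp add: mult.assoc exp_add[symmetric])
qed

lemma Ai_tendsto_0: "(Ai \<longlongrightarrow> 0) at_top"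
proof (rule Lim_transform_eventually[OF Ai_powr_tendsto_0[of 0]])
  show "\<forall>\<^sub>F x in at_top. Ai x * x powr 0 = Ai x"
    using eventually_gt_at_top[of 0] by eventually_elim simp
qed

lemma eventually_Ai_has_derivatives:
  "\<forall>\<^sub>F x in at_top. (Ai has_real_derivative deriv Ai x) (at x)"
  "\<forall>\<^sub>F x in at_top. (deriv Ai has_real_derivative x * Ai x) (at x)"
  using eventually_gt_at_top[of 0] by (eventually_elim, simp add: Ai_has_derivatives)+

lemma deriv_Ai_tendsto_0: "(deriv Ai \<longlongrightarrow> 0) at_top"
proof (rule deriv_tendsto_zero_if_convex[OF Ai_tendsto_0 eventually_Ai_has_derivatives])
  show "\<forall>\<^sub>F x in at_top. 0 \<le> x * Ai x"
    using Ai_eventually_pos eventually_gt_at_top[of 0] by eventually_elim simp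
qed

lemma deriv_Ai_eventually_neg: "\<forall>\<^sub>F x in at_top. deriv Ai x < 0"
proof -
  have "\<forall>\<^sub>F x in at_top. - deriv Ai x > 0"
  proof (rule eventually_pos_if_deriv_neg)
    show "\<forall>\<^sub>F x in at_top. ((\<lambda>x. - deriv Ai x) has_real_derivative - (x * Ai x)) (at x)"
      using eventually_Ai_has_derivatives(2) by eventually_elim (rule DERIV_minus)
    show "\<forall>\<^sub>F x in at_top. - (x * Ai x) < 0"
      using Ai_eventually_pos eventually_gt_at_top[of 0] by eventually_elim simp
    show "((\<lambda>x. - deriv Ai x) \<longlongrightarrow> 0) at_top"
      using tendsto_minus[OF deriv_Ai_tendsto_0] by simp
  qed
  then show ?thesis by simp
qed

text \<open>The integral of \<open>Ai\<^sup>2\<close> over \<open>[x, \<infinity>)\<close>, in closed form.\<close>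

definition airy_P :: "real \<Rightarrow> real" where
  "airy_P x = (deriv Ai x)\<^sup>2 - x * (Ai x)\<^sup>2"

lemma airy_P_deriv:
  assumes "x > 0" shows "(airy_P has_real_derivative - (Ai x)\<^sup>2) (at x)"
  unfolding airy_P_def
  by (rule derivative_eq_intros Ai_has_derivatives[OF assms] refl)+ (simp add: power2_eq_square)

lemma airy_P_tendsto_0: "(airy_P \<longlongrightarrow> 0) at_top"
proof -
  have "((\<lambda>x. (deriv Ai x)\<^sup>2 - (Ai x * x powr 1) * Ai x) \<longlongrightarrow> 0\<^sup>2 - 0 * 0) at_top"
    by (intro tendsto_intros deriv_Ai_tendsto_0 Ai_powr_tendsto_0 Ai_tendsto_0)
  then have "((\<lambda>x. (deriv Ai x)\<^sup>2 - (Ai x * x powr 1) * Ai x) \<longlongrightarrow> 0) at_top" by simp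
  moreover have "\<forall>\<^sub>F x in at_top. (deriv Ai x)\<^sup>2 - (Ai x * x powr 1) * Ai x = airy_P x"
    using eventually_gt_at_top[of 0] by eventually_elim (simp add: airy_P_def power2_eq_square)
  ultimately show ?thesis by (rule Lim_transform_eventually)
qed

text \<open>Positivity follows from the negative derivative and the limit 0; it means
  \<open>- Ai' > sqrt x Ai\<close>. That inequality in turn makes
  \<open>Ai^2 / (2 sqrt x) - airy_P\<close> nonincreasing with limit 0, which is the upper
  bound.\<close>

lemma airy_P_eventually_bounds:
  "\<forall>\<^sub>F x in at_top. airy_P x > 0"
  "\<forall>\<^sub>F x in at_top. airy_P x \<le> (Ai x)\<^sup>2 / (2 * sqrt x)"
proof -
  have P': "\<forall>\<^sub>F x in at_top. (airy_P has_real_derivative - (Ai x)\<^sup>2) (at x)"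
    using eventually_gt_at_top[of 0] by eventually_elim (rule airy_P_deriv)
  show pos: "\<forall>\<^sub>F x in at_top. airy_P x > 0"
    by (rule eventually_pos_if_deriv_neg[OF P' _ airy_P_tendsto_0])
      (use Ai_eventually_pos in \<open>eventually_elim, simp\<close>)
  have "\<forall>\<^sub>F x in at_top. 0 \<le> (Ai x)\<^sup>2 / (2 * sqrt x) - airy_P x"
  proof (rule eventually_nonneg_if_deriv_nonpos)
    show "\<forall>\<^sub>F x in at_top. ((\<lambda>x. (Ai x)\<^sup>2 / (2 * sqrt x) - airy_P x) has_real_derivative
        Ai x / sqrt x * (deriv Ai x + sqrt x * Ai x) - (Ai x)\<^sup>2 / (4 * x * sqrt x)) (at x)"
      using eventually_gt_at_top[of 0]
    proof eventually_elim
      case (elim x)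
      define k where "k = sqrt x"
      have k: "k > 0" "x = k\<^sup>2" using elim by (auto simp: k_def)
      have s: "(sqrt has_real_derivative 1 / (2 * sqrt x)) (at x)"
        using DERIV_real_sqrt[OF elim] by (simp add: field_simps)
      have "2 * sqrt x \<noteq> 0" using elim by simp
      from DERIV_diff[OF DERIV_divide[OF DERIV_power[OF Ai_has_derivatives(1)[OF elim], of 2]
          DERIV_cmult[OF s, of 2] this] airy_P_deriv[OF elim]]
      show ?case
        by (rule DERIV_cong) (unfold k_def[symmetric], use k in \<open>simp add: field_simps power2_eq_square\<close>)
    qed
    show "\<forall>\<^sub>F x in at_top. Ai x / sqrt x * (deriv Ai x + sqrt x * Ai x) - (Ai x)\<^sup>2 / (4 * x * sqrt x) \<le> 0"
      using Ai_eventually_pos pos deriv_Ai_eventually_neg eventually_gt_at_top[of 0]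
    proof eventually_elim
      case (elim x)
      have "(sqrt x * Ai x)\<^sup>2 \<le> (- deriv Ai x)\<^sup>2"
        using elim by (simp add: airy_P_def power_mult_distrib)
      then have "sqrt x * Ai x \<le> - deriv Ai x"
        by (rule power2_le_imp_le) (use elim in simp)
      then have "Ai x / sqrt x * (deriv Ai x + sqrt x * Ai x) \<le> 0"
        using elim by (intro mult_nonneg_nonpos) auto
      moreover have "(Ai x)\<^sup>2 / (4 * x * sqrt x) \<ge> 0" using elim by simp
      ultimately show ?case by linarith
    qed
    have "((\<lambda>x. 1 / (2 * sqrt x)) \<longlongrightarrow> (0::real)) at_top" by real_asymp
    from tendsto_diff[OF tendsto_mult[OF tendsto_power[OF Ai_tendsto_0, of 2] this] airy_P_tendsto_0]
    show "((\<lambda>x. (Ai x)\<^sup>2 / (2 * sqrt x) - airy_P x) \<longlongrightarrow> 0) at_top" by simp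
  qed
  then show "\<forall>\<^sub>F x in at_top. airy_P x \<le> (Ai x)\<^sup>2 / (2 * sqrt x)" by simp
qed

text \<open>The square of the quotient is \<open>1 + airy_P / (x Ai^2)\<close>, so the bounds on
  \<open>airy_P\<close> determine the limit without differentiating the asymptotics of
  \<open>Ai\<close>.\<close>

lemma deriv_Ai_asymp: "((\<lambda>x. deriv Ai x / (Ai x * sqrt x)) \<longlongrightarrow> - 1) at_top"
proof -
  have "((\<lambda>x. - (deriv Ai x / (Ai x * sqrt x))) \<longlongrightarrow> 1) at_top"
  proof (rule tendsto_sandwich)
    have sq: "(- (deriv Ai x / (Ai x * sqrt x)))\<^sup>2 = 1 + airy_P x / (x * (Ai x)\<^sup>2)"
      if "x > 0" "Ai x > 0" for x
      using that unfolding airy_P_def by (simp add: power_divide power_mult_distrib field_simps)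
    show lower: "\<forall>\<^sub>F x in at_top. 1 \<le> - (deriv Ai x / (Ai x * sqrt x))"
      using Ai_eventually_pos airy_P_eventually_bounds(1) deriv_Ai_eventually_neg eventually_gt_at_top[of 0]
    proof eventually_elim
      case (elim x)
      have "1\<^sup>2 \<le> (- (deriv Ai x / (Ai x * sqrt x)))\<^sup>2"
        using elim by (subst sq) auto
      then show ?case
        by (rule power2_le_imp_le) (use elim in \<open>auto simp: divide_le_0_iff\<close>)
    qed
    show "\<forall>\<^sub>F x in at_top. - (deriv Ai x / (Ai x * sqrt x)) \<le> 1 + 1 / (2 * x * sqrt x)"
      using lower Ai_eventually_pos airy_P_eventually_bounds(2) eventually_gt_at_top[of 0]
    proof eventually_elim
      case (elim x)
      let ?y = "- (deriv Ai x / (Ai x * sqrt x))"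
      \<comment> \<open>Since \<open>?y >= 1\<close>, it is at most its own square; this avoids
        taking a square root.\<close>
      have "?y * 1 \<le> ?y * ?y" by (rule mult_left_mono) (use elim in linarith)+
      also have "?y * ?y = 1 + airy_P x / (x * (Ai x)\<^sup>2)"
        using sq[of x] elim by (simp only: power2_eq_square)
      also have "airy_P x / (x * (Ai x)\<^sup>2) \<le> ((Ai x)\<^sup>2 / (2 * sqrt x)) / (x * (Ai x)\<^sup>2)"
        using elim by (intro divide_right_mono) auto
      also have "\<dots> = 1 / (2 * x * sqrt x)" using elim by (simp add: field_simps)
      finally show ?case by simp
    qed
    show "((\<lambda>x. 1 + 1 / (2 * x * sqrt x)) \<longlongrightarrow> (1::real)) at_top" by real_asymp
  qed simp
  from tendsto_minus[OF this] show ?thesis by simp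
qed

text \<open>The case \<open>c = 0\<close> is allowed and serves as a little-o statement.\<close>

definition Ai_lead :: "nat \<Rightarrow> real \<Rightarrow> real \<Rightarrow> (real \<Rightarrow> real) \<Rightarrow> bool" where
  "Ai_lead m j c F \<longleftrightarrow> ((\<lambda>x. F x / (Ai x ^ m * x powr j)) \<longlongrightarrow> c) at_top"

lemma Ai_lead_cong:
  assumes "Ai_lead m j c F" "\<forall>\<^sub>F x in at_top. F x = G x" shows "Ai_lead m j c G"
  using assms(1) unfolding Ai_lead_def
  by (rule Lim_transform_eventually) (use assms(2) in \<open>eventually_elim, simp\<close>)

lemma Ai_lead_add:
  "Ai_lead m j c F \<Longrightarrow> Ai_lead m j d G \<Longrightarrow> e = c + d \<Longrightarrow> Ai_lead m j e (\<lambda>x. F x + G x)"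
  unfolding Ai_lead_def by (simp add: add_divide_distrib tendsto_add)

lemma Ai_lead_diff:
  "Ai_lead m j c F \<Longrightarrow> Ai_lead m j d G \<Longrightarrow> e = c - d \<Longrightarrow> Ai_lead m j e (\<lambda>x. F x - G x)"
  unfolding Ai_lead_def by (simp add: diff_divide_distrib tendsto_diff)

lemma Ai_lead_minus: "Ai_lead m j c F \<Longrightarrow> Ai_lead m j (- c) (\<lambda>x. - F x)"
  unfolding Ai_lead_def by (simp add: tendsto_minus)

lemma Ai_lead_cmult: "Ai_lead m j c F \<Longrightarrow> e = a * c \<Longrightarrow> Ai_lead m j e (\<lambda>x. a * F x)"
  unfolding Ai_lead_def using tendsto_mult_left[of "\<lambda>x. F x / (Ai x ^ m * x powr j)" c at_top a] by simp

lemma Ai_lead_mult: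
  assumes "Ai_lead m j c F" "Ai_lead n k d G" and M: "M = m + n" and J: "J = j + k" and K: "K = c * d"
  shows "Ai_lead M J K (\<lambda>x. F x * G x)"
  unfolding Ai_lead_def M J K
proof (rule Lim_transform_eventually)
  show "((\<lambda>x. F x / (Ai x ^ m * x powr j) * (G x / (Ai x ^ n * x powr k))) \<longlongrightarrow> c * d) at_top"
    using assms(1,2) unfolding Ai_lead_def by (rule tendsto_mult)
  show "\<forall>\<^sub>F x in at_top. F x / (Ai x ^ m * x powr j) * (G x / (Ai x ^ n * x powr k)) =
      F x * G x / (Ai x ^ (m + n) * x powr (j + k))"
    using eventually_gt_at_top[of 0] by eventually_elim (simp add: powr_add power_add)
qed

text \<open>The exponents of \<open>Ai\<close> are natural numbers, so their relation is stated
  additively: the quotient must keep a nonnegative number of factors.\<close>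

lemma Ai_lead_divide:
  assumes "Ai_lead m j c F" "Ai_lead n k d G" "d \<noteq> 0"
    and M: "m = M + n" and J: "J = j - k" and K: "K = c / d"
  shows "Ai_lead M J K (\<lambda>x. F x / G x)"
  unfolding Ai_lead_def J K
proof (rule Lim_transform_eventually)
  show "((\<lambda>x. F x / (Ai x ^ m * x powr j) / (G x / (Ai x ^ n * x powr k))) \<longlongrightarrow> c / d) at_top"
    using assms(1-3) unfolding Ai_lead_def by (rule tendsto_divide)
  show "\<forall>\<^sub>F x in at_top. F x / (Ai x ^ m * x powr j) / (G x / (Ai x ^ n * x powr k)) =
      F x / G x / (Ai x ^ M * x powr (j - k))"
    using eventually_gt_at_top[of 0] Ai_eventually_pos
    by eventually_elim (simp add: M powr_diff power_add)
qed

lemma Ai_lead_Ai: "Ai_lead 1 0 1 Ai"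
  unfolding Ai_lead_def
proof (rule Lim_transform_eventually[OF tendsto_const])
  show "\<forall>\<^sub>F x in at_top. 1 = Ai x / (Ai x ^ 1 * x powr 0)"
    using Ai_eventually_pos eventually_gt_at_top[of 0] by eventually_elim simp
qed

lemma Ai_lead_ident: "Ai_lead 0 1 1 (\<lambda>x. x)"
  unfolding Ai_lead_def
proof (rule Lim_transform_eventually[OF tendsto_const])
  show "\<forall>\<^sub>F x in at_top. 1 = x / (Ai x ^ 0 * x powr 1)"
    using eventually_gt_at_top[of 0] by eventually_elim simp
qed

lemma Ai_lead_power:
  assumes "Ai_lead m j c F" "M = n * m" "J = real n * j" "K = c ^ n"
  shows "Ai_lead M J K (\<lambda>x. F x ^ n)"
  unfolding assms(2-4)
proof (induction n)
  case 0
  show ?case unfolding Ai_lead_def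
    by (rule Lim_transform_eventually[OF tendsto_const])
      (use eventually_gt_at_top[of 0] in \<open>eventually_elim, simp\<close>)
next
  case (Suc n)
  then show ?case
    unfolding power_Suc by (rule Ai_lead_mult[OF assms(1)]) (simp_all add: algebra_simps)
qed

lemma Ai_lead_tendsto_0_exp:
  assumes "Ai_lead m j c F" "m > 0" shows "((\<lambda>x. F x * x powr k * exp x) \<longlongrightarrow> 0) at_top"
proof -
  obtain n where n: "m = Suc n" using \<open>m > 0\<close> by (cases m) auto
  show ?thesis
  proof (rule Lim_transform_eventually)
    from tendsto_mult[OF tendsto_mult[OF assms(1)[unfolded Ai_lead_def] Ai_decay[of "j + k"]]
        tendsto_power[OF Ai_tendsto_0, of n]]
    show "((\<lambda>x. F x / (Ai x ^ m * x powr j) * (Ai x * x powr (j + k) * exp x) * Ai x ^ n) \<longlongrightarrow> 0) at_top"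
      by simp
    show "\<forall>\<^sub>F x in at_top. F x / (Ai x ^ m * x powr j) * (Ai x * x powr (j + k) * exp x) * Ai x ^ n =
        F x * x powr k * exp x"
      using eventually_gt_at_top[of 0] Ai_eventually_pos
      by eventually_elim (simp add: n powr_add)
  qed
qed

lemma Ai_lead_tendsto_0:
  assumes "Ai_lead m j c F" "m > 0" shows "(F \<longlongrightarrow> 0) at_top"
proof (rule Lim_transform_eventually)
  have "((\<lambda>x::real. exp (- x)) \<longlongrightarrow> 0) at_top" by real_asymp
  from tendsto_mult[OF Ai_lead_tendsto_0_exp[OF assms, of 0] this]
  show "((\<lambda>x. F x * x powr 0 * exp x * exp (- x)) \<longlongrightarrow> 0) at_top" by simp
  show "\<forall>\<^sub>F x in at_top. F x * x powr 0 * exp x * exp (- x) = F x"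
    using eventually_gt_at_top[of 0]
    by eventually_elim (simp add: mult.assoc exp_add[symmetric])
qed

text \<open>The exponent \<open>k\<close> is arbitrary, because one surplus factor of
  \<open>Ai\<close> absorbs every power of \<open>x\<close>.\<close>

lemma Ai_lead_lower:
  assumes "Ai_lead m j c F" "n < m" shows "Ai_lead n k 0 F"
proof -
  obtain i where i: "m = n + Suc i" using \<open>n < m\<close> less_imp_add_positive by (metis Suc_pred')
  show ?thesis
    unfolding Ai_lead_def
  proof (rule Lim_transform_eventually)
    from tendsto_mult[OF tendsto_mult[OF assms(1)[unfolded Ai_lead_def] Ai_powr_tendsto_0[of "j - k"]]
        tendsto_power[OF Ai_tendsto_0, of i]]
    show "((\<lambda>x. F x / (Ai x ^ m * x powr j) * (Ai x * x powr (j - k)) * Ai x ^ i) \<longlongrightarrow> 0) at_top"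
      by simp
    show "\<forall>\<^sub>F x in at_top. F x / (Ai x ^ m * x powr j) * (Ai x * x powr (j - k)) * Ai x ^ i =
        F x / (Ai x ^ n * x powr k)"
      using eventually_gt_at_top[of 0] Ai_eventually_pos
      by eventually_elim (simp add: i powr_diff power_add)
  qed
qed

lemma Ai_lead_lower_exponent:
  assumes "Ai_lead m j c F" "j < k" shows "Ai_lead m k 0 F"
  unfolding Ai_lead_def
proof (rule Lim_transform_eventually)
  have "((\<lambda>x::real. x powr (j - k)) \<longlongrightarrow> 0) at_top"
    using \<open>j < k\<close> by (intro tendsto_neg_powr filterlim_ident) auto
  from tendsto_mult[OF assms(1)[unfolded Ai_lead_def] this]
  show "((\<lambda>x. F x / (Ai x ^ m * x powr j) * x powr (j - k)) \<longlongrightarrow> 0) at_top"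
    by simp
  show "\<forall>\<^sub>F x in at_top. F x / (Ai x ^ m * x powr j) * x powr (j - k) = F x / (Ai x ^ m * x powr k)"
    using eventually_gt_at_top[of 0] by eventually_elim (simp add: powr_diff)
qed

lemma Ai_lead_deriv_Ai: "Ai_lead 1 (1 / 2) (- 1) (deriv Ai)"
  unfolding Ai_lead_def
proof (rule Lim_transform_eventually[OF deriv_Ai_asymp])
  show "\<forall>\<^sub>F x in at_top. deriv Ai x / (Ai x * sqrt x) = deriv Ai x / (Ai x ^ 1 * x powr (1 / 2))"
    using eventually_gt_at_top[of 0] by eventually_elim (simp add: powr_half_sqrt)
qed

text \<open>L'Hospital's rule against \<open>Ai^m x^(j - 1/2)\<close>, whose derivative is \<open>\<sim> -m Ai^m x^j\<close>.\<close>

lemma Ai_lead_integrate: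
  assumes F': "\<forall>\<^sub>F x in at_top. (F has_real_derivative F' x) (at x)" and F: "(F \<longlongrightarrow> 0) at_top"
    and lead: "Ai_lead m j c F'" and m: "m > 0" and J: "J = j - 1 / 2" and K: "K = - c / real m"
  shows "Ai_lead m J K F"
  unfolding Ai_lead_def J K
proof (rule lhopital_zero_at_top[OF F _ F'])
  \<comment> \<open>The derivative of \<open>Ai^m x powr (j - 1 / 2)\<close> with
    \<open>Ai^m x powr j\<close> factored out; the bracket tends to \<open>- m\<close>.\<close>
  define G' where "G' = (\<lambda>x. Ai x ^ m * x powr j * (real m * (deriv Ai x / (Ai x * sqrt x)) + (j - 1 / 2) * x powr (- 3 / 2)))"
  have "((\<lambda>x::real. x powr (- 3 / 2)) \<longlongrightarrow> 0) at_top" by real_asymp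
  then have lim: "((\<lambda>x. real m * (deriv Ai x / (Ai x * sqrt x)) + (j - 1 / 2) * x powr (- 3 / 2)) \<longlongrightarrow>
      real m * (- 1) + (j - 1 / 2) * 0) at_top"
    by (intro tendsto_intros deriv_Ai_asymp)
  obtain n where n: "m = Suc n" using m by (cases m) auto
  show "\<forall>\<^sub>F x in at_top. ((\<lambda>x. Ai x ^ m * x powr (j - 1 / 2)) has_real_derivative G' x) (at x)"
    using Ai_eventually_pos eventually_gt_at_top[of 0]
  proof eventually_elim
    case (elim x)
    have e: "x powr (j - 1 / 2 - 1) = x powr j * x powr (- 3 / 2)" "x powr (j - 1 / 2) = x powr j / sqrt x"
      using elim by (simp_all add: powr_add[symmetric] powr_diff powr_half_sqrt)
    note deriv = DERIV_mult[OF DERIV_power[OF Ai_has_derivatives(1)[OF elim(2)], of m]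
      has_real_derivative_powr[OF elim(2), of "j - 1 / 2"]]
    have "\<mu> * (d * B) * (X / S) + \<nu> * (X * Y) * (a * B) = a * B * X * (\<mu> * (d / (a * S)) + \<nu> * Y)"
      if "a \<noteq> 0" "S \<noteq> 0" for a B d S X Y \<mu> \<nu> :: real
      using that by (simp add: field_simps)
    then have "real m * (deriv Ai x * Ai x ^ n) * (x powr j / sqrt x) + (j - 1 / 2) * (x powr j * x powr (- 3 / 2)) * (Ai x * Ai x ^ n) = G' x"
      unfolding G'_def n power_Suc using elim by simp
    with deriv show ?case
      unfolding e n power_Suc diff_Suc_1' by simp
  qed
  show "\<forall>\<^sub>F x in at_top. G' x < 0"
    using order_tendstoD(2)[OF lim, of 0] Ai_eventually_pos eventually_gt_at_top[of 0]
  proof (rule eventually_elim2[OF _ eventually_conj])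
    fix x assume "real m * (deriv Ai x / (Ai x * sqrt x)) + (j - 1 / 2) * x powr (- 3 / 2) < 0"
      and "0 < Ai x \<and> 0 < x"
    then show "G' x < 0" unfolding G'_def by (intro mult_pos_neg) auto
  qed (use m in auto)
  show "((\<lambda>x. F' x / G' x) \<longlongrightarrow> - c / real m) at_top"
    using tendsto_divide[OF lead[unfolded Ai_lead_def] lim] m by (simp add: G'_def)
  show "((\<lambda>x. Ai x ^ m * x powr (j - 1 / 2)) \<longlongrightarrow> 0) at_top"
  proof (rule Lim_transform_eventually)
    from tendsto_mult[OF Ai_powr_tendsto_0[of "j - 1 / 2"] tendsto_power[OF Ai_tendsto_0, of n]]
    show "((\<lambda>x. Ai x * x powr (j - 1 / 2) * Ai x ^ n) \<longlongrightarrow> 0) at_top" by simp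
  qed (simp add: n)
qed

text \<open>A leading term with \<open>m > 0\<close> forces \<open>|F x| <= exp (- x)\<close>
  eventually, and this puts the tail lemmas for exponentially dominated functions at
  disposal.\<close>

lemma Ai_lead_tail:
  assumes lead: "Ai_lead m j c F" and m: "m > 0" and cont: "\<forall>\<^sub>F x in at_top. isCont F x"
  shows "\<forall>\<^sub>F s in at_top. F integrable_on {s..}"
    and "\<forall>\<^sub>F s in at_top. ((\<lambda>s. integral {s..} F) has_real_derivative - F s) (at s)"
    and "((\<lambda>s. integral {s..} F) \<longlongrightarrow> 0) at_top"
    and "J = j - 1 / 2 \<Longrightarrow> K = c / real m \<Longrightarrow> Ai_lead m J K (\<lambda>s. integral {s..} F)"
proof -
  have "((\<lambda>x. \<bar>F x * x powr 0 * exp x\<bar>) \<longlongrightarrow> 0) at_top"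
    using Ai_lead_tendsto_0_exp[OF lead m, of 0] by (rule tendsto_rabs_zero)
  from order_tendstoD(2)[OF this zero_less_one] cont eventually_gt_at_top[of 0]
  have "\<forall>\<^sub>F x in at_top. isCont F x \<and> \<bar>F x\<bar> \<le> 1 * exp (- x)"
  proof eventually_elim
    case (elim x)
    then show ?case by (simp add: abs_mult exp_minus field_simps)
  qed
  then obtain a where a: "\<And>x. x \<ge> a \<Longrightarrow> isCont F x" "\<And>x. x \<ge> a \<Longrightarrow> \<bar>F x\<bar> \<le> 1 * exp (- x)"
    unfolding eventually_at_top_linorder by blast
  have c: "continuous_on {a..} F"
    by (intro continuous_at_imp_continuous_on ballI a) simp
  show "\<forall>\<^sub>F s in at_top. F integrable_on {s..}"
    using eventually_ge_at_top[of a] by eventually_elim (rule exp_dominated_tail(1)[OF c a(2)])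
  show D: "\<forall>\<^sub>F s in at_top. ((\<lambda>s. integral {s..} F) has_real_derivative - F s) (at s)"
    using eventually_gt_at_top[of a] by eventually_elim (rule exp_dominated_tail_deriv[OF c a(2)])
  show T: "((\<lambda>s. integral {s..} F) \<longlongrightarrow> 0) at_top"
    by (rule exp_dominated_tail_tendsto_0[OF c a(2)])
  show "Ai_lead m J K (\<lambda>s. integral {s..} F)" if "J = j - 1 / 2" "K = c / real m"
    by (rule Ai_lead_integrate[OF D T Ai_lead_minus[OF lead] m]) (use that in auto)
qed

section \<open>Leading coefficients of the functions built from airy_P\<close>

lemma airy_P_eventually_deriv: "\<forall>\<^sub>F x in at_top. (airy_P has_real_derivative - (Ai x)\<^sup>2) (at x)"
  using eventually_gt_at_top[of 0] by eventually_elim (rule airy_P_deriv)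

lemma Ai_lead_Ai_power: "Ai_lead n 0 1 (\<lambda>x. Ai x ^ n)"
  by (rule Ai_lead_power[OF Ai_lead_Ai]) auto

lemma Ai_lead_airy_P: "Ai_lead 2 (- 1 / 2) (1 / 2) airy_P"
  by (rule Ai_lead_integrate[OF airy_P_eventually_deriv airy_P_tendsto_0 Ai_lead_minus[OF Ai_lead_Ai_power]]) auto

text \<open>
  With \<open>p = airy_P / Ai\<^sup>2\<close>, the logarithmic derivative \<open>r = Ai' / Ai\<close> satisfies \<open>r\<^sup>2 = x + p\<close>, \<open>r' = - p\<close> and
  \<open>p' = - 2 r p - 1\<close>.  The functions below are \<open>airy_Q = Ai\<^sup>2 p'\<close> and \<open>airy_R = Ai\<^sup>2 (2 p\<^sup>3 + p')\<close>.
\<close>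

definition airy_Q :: "real \<Rightarrow> real" where
  "airy_Q x = - 2 * (deriv Ai x * airy_P x / Ai x) - (Ai x)\<^sup>2"

definition airy_R :: "real \<Rightarrow> real" where
  "airy_R x = 2 * (airy_P x ^ 3 / Ai x ^ 4) + airy_Q x"

lemma airy_Q_eventually_deriv:
  "\<forall>\<^sub>F x in at_top. (airy_Q has_real_derivative 2 * ((airy_P x)\<^sup>2 / (Ai x)\<^sup>2)) (at x)"
  using eventually_gt_at_top[of 0] Ai_eventually_pos
proof eventually_elim
  case (elim x)
  then have "Ai x \<noteq> 0" by simp
  note A = Ai_has_derivatives(1)[OF elim(1)]
  from DERIV_diff[OF DERIV_cmult[OF DERIV_divide[OF DERIV_mult[OF Ai_has_derivatives(2)[OF elim(1)] airy_P_deriv[OF elim(1)]] A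
      \<open>Ai x \<noteq> 0\<close>], of "- 2"] DERIV_power[OF A, of 2]]
  show ?case unfolding airy_Q_def[abs_def]
    by (rule DERIV_cong) (use \<open>Ai x \<noteq> 0\<close> in \<open>simp add: airy_P_def field_simps power2_eq_square\<close>)
qed

lemma Ai_lead_airy_Q: "Ai_lead 2 (- 3 / 2) (- 1 / 4) airy_Q"
proof (rule Ai_lead_integrate[OF airy_Q_eventually_deriv])
  \<comment> \<open>At order \<open>Ai^2\<close> the two summands contribute \<open>1\<close> and
    \<open>- 1\<close>. Only the limit 0 is read off here; the true coefficient comes from
    integrating the derivative, where nothing cancels.\<close>
  have "Ai_lead 2 0 0 airy_Q"
    unfolding airy_Q_def[abs_def]
    by (rule Ai_lead_diff[OF Ai_lead_cmult[OF Ai_lead_divide[OF Ai_lead_mult[OF Ai_lead_deriv_Ai Ai_lead_airy_P refl refl refl]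
        Ai_lead_Ai]] Ai_lead_Ai_power]) auto
  then show "(airy_Q \<longlongrightarrow> 0) at_top" by (rule Ai_lead_tendsto_0) simp
  show "Ai_lead 2 (- 1) (1 / 2) (\<lambda>x. 2 * ((airy_P x)\<^sup>2 / (Ai x)\<^sup>2))"
    by (rule Ai_lead_cmult[where c = "1 / 4", OF Ai_lead_divide[OF Ai_lead_power[OF Ai_lead_airy_P refl refl refl] Ai_lead_Ai_power]])
      (auto simp: power2_eq_square)
qed auto

lemma airy_R_eventually_deriv:
  "\<forall>\<^sub>F x in at_top. (airy_R has_real_derivative 4 * ((airy_P x)\<^sup>2 * airy_Q x / Ai x ^ 4)) (at x)"
  using eventually_gt_at_top[of 0] Ai_eventually_pos airy_Q_eventually_deriv
proof eventually_elim
  case (elim x)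
  then have "Ai x ^ 4 \<noteq> 0" by simp
  from DERIV_add[OF DERIV_cmult[OF DERIV_divide[OF DERIV_power[OF airy_P_deriv[OF elim(1)], of 3]
      DERIV_power[OF Ai_has_derivatives(1)[OF elim(1)], of 4] \<open>Ai x ^ 4 \<noteq> 0\<close>], of 2] elim(3)]
  show ?case unfolding airy_R_def[abs_def]
    by (rule DERIV_cong) (use elim in \<open>simp add: airy_Q_def field_simps eval_nat_numeral\<close>)
qed

text \<open>The summands have opposite leading coefficients \<open>1 / 4\<close> and
  \<open>- 1 / 4\<close>, so the size is again taken from the derivative, a single monomial with
  coefficient \<open>4 * (1 / 4) * (- 1 / 4)\<close>.\<close>

lemma Ai_lead_airy_R: "Ai_lead 2 (- 3) (1 / 8) airy_R"
proof (rule Ai_lead_integrate[OF airy_R_eventually_deriv])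
  have "Ai_lead 2 (- 3 / 2) 0 airy_R"
    unfolding airy_R_def[abs_def]
    by (rule Ai_lead_add[where c = "1 / 4", OF Ai_lead_cmult[where c = "1 / 8", OF Ai_lead_divide[OF Ai_lead_power[OF Ai_lead_airy_P refl refl refl, of 3]
        Ai_lead_Ai_power[of 4]]] Ai_lead_airy_Q])
      (auto simp: eval_nat_numeral)
  then show "(airy_R \<longlongrightarrow> 0) at_top" by (rule Ai_lead_tendsto_0) simp
  show "Ai_lead 2 (- 5 / 2) (- 1 / 4) (\<lambda>x. 4 * ((airy_P x)\<^sup>2 * airy_Q x / Ai x ^ 4))"
    by (rule Ai_lead_cmult[OF Ai_lead_divide[OF Ai_lead_mult[OF Ai_lead_power[OF Ai_lead_airy_P refl refl refl, of 2]
        Ai_lead_airy_Q refl refl refl] Ai_lead_Ai_power[of 4]]])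
      (auto simp: power2_eq_square)
qed auto

lemma eventually_isCont_Ai: "\<forall>\<^sub>F x in at_top. isCont Ai x"
  using eventually_Ai_has_derivatives(1) by eventually_elim (rule DERIV_isCont)

lemma eventually_isCont_airy_P: "\<forall>\<^sub>F x in at_top. isCont airy_P x"
  using airy_P_eventually_deriv by eventually_elim (rule DERIV_isCont)

lemma Fhat2_eq_airy_P: "Fhat2 = (\<lambda>s. integral {s..} airy_P)"
  unfolding Fhat2_def[abs_def] airy_P_def[abs_def] ..

lemmas Fhat2_tail = Ai_lead_tail[OF Ai_lead_airy_P zero_less_numeral eventually_isCont_airy_P, folded Fhat2_eq_airy_P]

lemma Ai_lead_Fhat2: "Ai_lead 2 (- 1) (1 / 4) Fhat2"
  by (rule Fhat2_tail(4)) auto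

text \<open>\<open>Ai^2\<close> times the derivative of
  \<open>Fhat2 / 2 + airy_P^2 / (2 Ai^2)\<close>. That function will approximate the relative
  correction \<open>y\<close> of \<open>q\<close>, and \<open>airy_N\<close> then plays the part
  that the Wronskian plays for \<open>y\<close>.\<close>

definition airy_N :: "real \<Rightarrow> real" where
  "airy_N x = - ((Ai x)\<^sup>2 * airy_P x) + 1 / 2 * (airy_P x * airy_Q x)"

text \<open>The summand \<open>2 Ai^4\<close> is exactly the leading part of the derivative
  \<open>2 Ai q^3\<close> of the Wronskian, and the remainder is smaller by a factor of order
  \<open>x powr (- 3)\<close>.\<close>

lemma airy_N_eventually_deriv:
  "\<forall>\<^sub>F x in at_top. (airy_N has_real_derivative 2 * Ai x ^ 4 + 1 / 2 * ((Ai x)\<^sup>2 * airy_R x)) (at x)"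
  using eventually_gt_at_top[of 0] Ai_eventually_pos airy_Q_eventually_deriv
proof eventually_elim
  case (elim x)
  from DERIV_add[OF DERIV_minus[OF DERIV_mult[OF DERIV_power[OF Ai_has_derivatives(1)[OF elim(1)], of 2] airy_P_deriv[OF elim(1)]]]
    DERIV_cmult[OF DERIV_mult[OF airy_P_deriv[OF elim(1)] elim(3)], of "1 / 2"]]
  show ?case unfolding airy_N_def[abs_def]
    by (rule DERIV_cong) (use elim in \<open>simp add: airy_R_def airy_Q_def field_simps eval_nat_numeral\<close>)
qed

lemma Fhat2_airy_P_eventually_deriv:
  "\<forall>\<^sub>F x in at_top. ((\<lambda>x. 1 / 2 * Fhat2 x + 1 / 2 * ((airy_P x)\<^sup>2 / (Ai x)\<^sup>2)) has_real_derivative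
     airy_N x / (Ai x)\<^sup>2) (at x)"
  using eventually_gt_at_top[of 0] Ai_eventually_pos Fhat2_tail(2)
proof eventually_elim
  case (elim x)
  then have "(Ai x)\<^sup>2 \<noteq> 0" by simp
  from DERIV_add[OF DERIV_cmult[OF elim(3), of "1 / 2"] DERIV_cmult[OF DERIV_divide[OF DERIV_power[OF airy_P_deriv[OF elim(1)], of 2]
    DERIV_power[OF Ai_has_derivatives(1)[OF elim(1)], of 2] this], of "1 / 2"]]
  show ?case
    by (rule DERIV_cong) (use elim in \<open>simp add: airy_N_def airy_Q_def field_simps eval_nat_numeral\<close>)
qed

section \<open>Taylor remainders of the exponential at small arguments\<close>

lemma exp_remainder_3: "((\<lambda>z::real. (exp (- z) - 1 + z - z\<^sup>2 / 2) / z ^ 3) \<longlongrightarrow> - 1 / 6) (at 0)"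
  by real_asymp

lemma exp_remainder_1: "((\<lambda>z::real. (1 - exp (- z)) / z) \<longlongrightarrow> 1) (at 0)"
  by real_asymp

text \<open>The remainder quotients have only a punctured limit at 0; \<open>c \<noteq> 0\<close>
  ensures that \<open>F\<close> tends to 0 without eventually taking the value 0.\<close>

lemma Ai_lead_compose:
  assumes g: "(g \<longlongrightarrow> d) (at 0)" and lead: "Ai_lead m j c F" and "m > 0" "c \<noteq> 0"
  shows "Ai_lead 0 0 d (\<lambda>x. g (F x))" and "\<forall>\<^sub>F x in at_top. F x \<noteq> 0"
proof -
  have "\<forall>\<^sub>F x in at_top. F x / (Ai x ^ m * x powr j) \<noteq> 0"
    using lead \<open>c \<noteq> 0\<close> unfolding Ai_lead_def by (rule tendsto_imp_eventually_ne)
  then show nz: "\<forall>\<^sub>F x in at_top. F x \<noteq> 0" by eventually_elim auto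
  have "filterlim F (at 0) at_top"
    using Ai_lead_tendsto_0[OF lead \<open>m > 0\<close>] nz by (rule filterlim_atI)
  from filterlim_compose[OF g this]
  show "Ai_lead 0 0 d (\<lambda>x. g (F x))"
    unfolding Ai_lead_def
    by (rule Lim_transform_eventually) (use eventually_gt_at_top[of 0] in \<open>eventually_elim, simp\<close>)
qed

lemma Ai_lead_exp_remainder_1:
  assumes "Ai_lead m j c F" "m > 0" "c \<noteq> 0" shows "Ai_lead m j c (\<lambda>x. 1 - exp (- F x))"
proof (rule Ai_lead_cong)
  show "Ai_lead m j c (\<lambda>x. F x * ((1 - exp (- F x)) / F x))"
    by (rule Ai_lead_mult[OF assms(1) Ai_lead_compose(1)[OF exp_remainder_1 assms]]) auto
  show "\<forall>\<^sub>F x in at_top. F x * ((1 - exp (- F x)) / F x) = 1 - exp (- F x)"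
    using Ai_lead_compose(2)[OF exp_remainder_1 assms] by eventually_elim simp
qed

lemma Ai_lead_exp_remainder_3:
  assumes "Ai_lead m j c F" "m > 0" "c \<noteq> 0"
  shows "Ai_lead (3 * m) (3 * j) (- (c ^ 3) / 6) (\<lambda>x. exp (- F x) - 1 + F x - (F x)\<^sup>2 / 2)"
proof (rule Ai_lead_cong)
  show "Ai_lead (3 * m) (3 * j) (- (c ^ 3) / 6) (\<lambda>x. F x ^ 3 * ((exp (- F x) - 1 + F x - (F x)\<^sup>2 / 2) / F x ^ 3))"
    by (rule Ai_lead_mult[OF Ai_lead_power[OF assms(1) refl refl refl] Ai_lead_compose(1)[OF exp_remainder_3 assms]]) auto
  show "\<forall>\<^sub>F x in at_top. F x ^ 3 * ((exp (- F x) - 1 + F x - (F x)\<^sup>2 / 2) / F x ^ 3) = exp (- F x) - 1 + F x - (F x)\<^sup>2 / 2"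
    using Ai_lead_compose(2)[OF exp_remainder_3 assms] by eventually_elim simp
qed

lemma Ai_lead_imp_asymp_equiv:
  assumes lead: "Ai_lead m j c F" and "c \<noteq> 0"
  shows "F \<sim>[at_top] (\<lambda>x. c * (Ai x ^ m * x powr j))"
proof (rule asymp_equivI')
  from tendsto_divide[OF lead[unfolded Ai_lead_def] tendsto_const[of c]] \<open>c \<noteq> 0\<close>
  show "((\<lambda>x. F x / (c * (Ai x ^ m * x powr j))) \<longlongrightarrow> 1) at_top"
    by (simp add: mult.commute)
qed

lemma Ai_asymp_equiv: "Ai \<sim>[at_top] (\<lambda>x. exp (- (2 / 3) * x powr (3 / 2)) * x powr (- 1 / 4) / (2 * sqrt pi))"
  by (rule asymp_equivI'[OF Ai_asymp])

section \<open>The Hastings--McLeod solution\<close>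

locale hastings_mcleod_solution =
  fixes q :: "real \<Rightarrow> real"
  assumes hm: "hastings_mcleod q"
begin

lemma q_deriv: "(q has_real_derivative deriv q x) (at x)"
  and deriv_q_deriv: "(deriv q has_real_derivative 2 * q x ^ 3 + x * q x) (at x)"
  using hm unfolding hastings_mcleod_def
  by (auto intro!: DERIV_deriv_iff_real_differentiable[THEN iffD2])

lemma isCont_q: "isCont q x"
  using DERIV_isCont[OF q_deriv] .

lemma Ai_lead_q: "Ai_lead 1 0 1 q"
  unfolding Ai_lead_def
proof (rule Lim_transform_eventually)
  show "((\<lambda>x. q x / Ai x) \<longlongrightarrow> 1) at_top"
    using hm Ai_eventually_pos unfolding hastings_mcleod_def
    by (intro asymp_equivD_strong) (auto elim: eventually_mono)
  show "\<forall>\<^sub>F x in at_top. q x / Ai x = q x / (Ai x ^ 1 * x powr 0)"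
    using eventually_gt_at_top[of 0] by eventually_elim simp
qed

lemma q_tendsto_0: "(q \<longlongrightarrow> 0) at_top"
  using Ai_lead_q by (rule Ai_lead_tendsto_0) simp

lemma q_eventually_pos: "\<forall>\<^sub>F x in at_top. q x > 0"
  using order_tendstoD(1)[OF Ai_lead_q[unfolded Ai_lead_def] zero_less_one] eventually_gt_at_top[of 0] Ai_eventually_pos
  by eventually_elim (simp add: zero_less_divide_iff)

lemma deriv_q_tendsto_0: "(deriv q \<longlongrightarrow> 0) at_top"
proof (rule deriv_tendsto_zero_if_convex[OF q_tendsto_0])
  show "\<forall>\<^sub>F x in at_top. 0 \<le> 2 * q x ^ 3 + x * q x"
    using q_eventually_pos eventually_gt_at_top[of 0] by eventually_elim simp
qed (simp_all add: q_deriv deriv_q_deriv)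

section \<open>The correction of q relative to Ai\<close>

definition wronskian :: "real \<Rightarrow> real" where
  "wronskian x = deriv q x * Ai x - q x * deriv Ai x"

text \<open>Reduction of order: \<open>y' = wronskian / Ai^2\<close>, so \<open>y\<close> is reached
  from Painleve II by two first-order integrations, both with limit 0 at infinity.\<close>

definition y :: "real \<Rightarrow> real" where
  "y x = q x / Ai x - 1"

text \<open>The terms \<open>x q Ai\<close> of the two second derivatives cancel, and only the
  nonlinearity of Painleve II is left.\<close>

lemma wronskian_eventually_deriv:
  "\<forall>\<^sub>F x in at_top. (wronskian has_real_derivative 2 * (Ai x * q x ^ 3)) (at x)"
  using eventually_gt_at_top[of 0]
proof eventually_elim
  case (elim x)
  show ?case unfolding wronskian_def[abs_def]
    by (rule derivative_eq_intros q_deriv deriv_q_deriv Ai_has_derivatives[OF elim] refl)+ (simp add: algebra_simps)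
qed

lemma wronskian_tendsto_0: "(wronskian \<longlongrightarrow> 0) at_top"
  unfolding wronskian_def[abs_def]
  using tendsto_diff[OF tendsto_mult[OF deriv_q_tendsto_0 Ai_tendsto_0] tendsto_mult[OF q_tendsto_0 deriv_Ai_tendsto_0]]
  by simp

lemma Ai_lead_wronskian: "Ai_lead 4 (- 1 / 2) (- 1 / 2) wronskian"
proof (rule Ai_lead_integrate[OF wronskian_eventually_deriv wronskian_tendsto_0])
  show "Ai_lead 4 0 2 (\<lambda>x. 2 * (Ai x * q x ^ 3))"
    by (rule Ai_lead_cmult[where c = 1, OF Ai_lead_mult[OF Ai_lead_Ai Ai_lead_power[OF Ai_lead_q refl refl refl]]]) auto
qed auto

lemma y_eventually_deriv: "\<forall>\<^sub>F x in at_top. (y has_real_derivative wronskian x / (Ai x)\<^sup>2) (at x)"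
  using eventually_gt_at_top[of 0] Ai_eventually_pos
proof eventually_elim
  case (elim x)
  then have "Ai x \<noteq> 0" by simp
  from DERIV_diff[OF DERIV_divide[OF q_deriv Ai_has_derivatives(1)[OF elim(1)] this] DERIV_const[of 1]]
  show ?case unfolding y_def[abs_def] wronskian_def
    by (rule DERIV_cong) (simp add: power2_eq_square)
qed

lemma y_tendsto_0: "(y \<longlongrightarrow> 0) at_top"
proof (rule Lim_transform_eventually)
  show "((\<lambda>x. q x / (Ai x ^ 1 * x powr 0) - 1) \<longlongrightarrow> 0) at_top"
    using tendsto_diff[OF Ai_lead_q[unfolded Ai_lead_def] tendsto_const[of 1]] by simp
  show "\<forall>\<^sub>F x in at_top. q x / (Ai x ^ 1 * x powr 0) - 1 = y x"
    using eventually_gt_at_top[of 0] by eventually_elim (simp add: y_def)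
qed

lemma Ai_lead_y: "Ai_lead 2 (- 1) (1 / 4) y"
  by (rule Ai_lead_integrate[OF y_eventually_deriv y_tendsto_0 Ai_lead_divide[OF Ai_lead_wronskian Ai_lead_Ai_power]]) auto

lemma q_eq: "\<forall>\<^sub>F x in at_top. q x = Ai x * (1 + y x)"
  using Ai_eventually_pos by eventually_elim (simp add: y_def)

text \<open>
  If \<open>z\<close> were zero, all terms of order \<open>Ai\<^sup>4\<close> in the second derivative of \<open>Fhat2 - F_TW2\<close> would cancel.
\<close>

definition z :: "real \<Rightarrow> real" where
  "z x = 1 / 2 * Fhat2 x + 1 / 2 * ((airy_P x)\<^sup>2 / (Ai x)\<^sup>2) - y x"

text \<open>With \<open>q = Ai (1 + y)\<close> the terms \<open>2 Ai^4\<close> in the two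
  derivatives cancel. What remains is \<open>Ai^2 airy_R / 2\<close>, of size
  \<open>Ai^4 / (16 x^3)\<close>; all terms containing \<open>y\<close> carry at least six factors
  of \<open>Ai\<close>.\<close>

lemma Ai_lead_airy_N_minus_wronskian: "Ai_lead 4 (- 7 / 2) (- 1 / 64) (\<lambda>x. airy_N x - wronskian x)"
proof (rule Ai_lead_integrate)
  show "\<forall>\<^sub>F x in at_top. ((\<lambda>x. airy_N x - wronskian x) has_real_derivative
      2 * Ai x ^ 4 + 1 / 2 * ((Ai x)\<^sup>2 * airy_R x) - 2 * (Ai x * q x ^ 3)) (at x)"
    using airy_N_eventually_deriv wronskian_eventually_deriv by eventually_elim (rule DERIV_diff)
  have "Ai_lead 4 (- 1 / 2) (- 1 / 2) airy_N"
    unfolding airy_N_def[abs_def]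
  proof (rule Ai_lead_add)
    show "Ai_lead 4 (- 1 / 2) (- (1 / 2)) (\<lambda>x. - ((Ai x)\<^sup>2 * airy_P x))"
      by (rule Ai_lead_minus[OF Ai_lead_mult[OF Ai_lead_Ai_power Ai_lead_airy_P]]) auto
    have "Ai_lead 4 (- 2) (- 1 / 8) (\<lambda>x. airy_P x * airy_Q x)"
      by (rule Ai_lead_mult[OF Ai_lead_airy_P Ai_lead_airy_Q]) auto
    then have "Ai_lead 4 (- 1 / 2) 0 (\<lambda>x. airy_P x * airy_Q x)"
      by (rule Ai_lead_lower_exponent) simp
    then show "Ai_lead 4 (- 1 / 2) 0 (\<lambda>x. 1 / 2 * (airy_P x * airy_Q x))"
      by (rule Ai_lead_cmult) simp
  qed simp
  then have "(airy_N \<longlongrightarrow> 0) at_top" by (rule Ai_lead_tendsto_0) simp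
  from tendsto_diff[OF this wronskian_tendsto_0]
  show "((\<lambda>x. airy_N x - wronskian x) \<longlongrightarrow> 0) at_top" by simp
  show "Ai_lead 4 (- 3) (1 / 16) (\<lambda>x. 2 * Ai x ^ 4 + 1 / 2 * ((Ai x)\<^sup>2 * airy_R x) - 2 * (Ai x * q x ^ 3))"
  proof (rule Ai_lead_cong)
    have y2: "Ai_lead 2 (- 1) 0 (\<lambda>x. (y x)\<^sup>2)" and y3: "Ai_lead 2 (- 1) 0 (\<lambda>x. y x ^ 3)"
      by (rule Ai_lead_lower[OF Ai_lead_power[OF Ai_lead_y refl refl refl]], simp)+
    have "Ai_lead 2 (- 1) (3 / 4) (\<lambda>x. 3 * y x + 3 * (y x)\<^sup>2 + y x ^ 3)"
      by (rule Ai_lead_add[OF Ai_lead_add[OF Ai_lead_cmult[OF Ai_lead_y refl] Ai_lead_cmult[OF y2 refl] refl] y3]) simp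
    then have 1: "Ai_lead 6 (- 1) (3 / 2) (\<lambda>x. 2 * (Ai x ^ 4 * (3 * y x + 3 * (y x)\<^sup>2 + y x ^ 3)))"
      by (intro Ai_lead_cmult[OF Ai_lead_mult[OF Ai_lead_Ai_power[of 4]]]) auto
    have 2: "Ai_lead 4 (- 3) (1 / 8) (\<lambda>x. (Ai x)\<^sup>2 * airy_R x)"
      by (rule Ai_lead_mult[OF Ai_lead_Ai_power Ai_lead_airy_R]) auto
    show "Ai_lead 4 (- 3) (1 / 16) (\<lambda>x. 1 / 2 * ((Ai x)\<^sup>2 * airy_R x) - 2 * (Ai x ^ 4 * (3 * y x + 3 * (y x)\<^sup>2 + y x ^ 3)))"
      by (rule Ai_lead_diff[OF Ai_lead_cmult[OF 2 refl] Ai_lead_lower[OF 1]]) auto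
    show "\<forall>\<^sub>F x in at_top. 1 / 2 * ((Ai x)\<^sup>2 * airy_R x) - 2 * (Ai x ^ 4 * (3 * y x + 3 * (y x)\<^sup>2 + y x ^ 3)) =
        2 * Ai x ^ 4 + 1 / 2 * ((Ai x)\<^sup>2 * airy_R x) - 2 * (Ai x * q x ^ 3)"
      using q_eq
    proof eventually_elim
      case (elim x)
      then show ?case by algebra
    qed
  qed
qed auto

lemma Ai_lead_z: "Ai_lead 2 (- 4) (1 / 128) z"
proof (rule Ai_lead_integrate)
  show "\<forall>\<^sub>F x in at_top. (z has_real_derivative (airy_N x - wronskian x) / (Ai x)\<^sup>2) (at x)"
    using Fhat2_airy_P_eventually_deriv y_eventually_deriv
    unfolding z_def[abs_def] diff_divide_distrib by eventually_elim (rule DERIV_diff)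
  have "Ai_lead 2 (- 1) (1 / 4) (\<lambda>x. (airy_P x)\<^sup>2 / (Ai x)\<^sup>2)"
    by (rule Ai_lead_divide[OF Ai_lead_power[OF Ai_lead_airy_P refl refl refl] Ai_lead_Ai_power])
      (auto simp: power2_eq_square)
  from Ai_lead_diff[OF Ai_lead_add[OF Ai_lead_cmult[OF Ai_lead_Fhat2 refl] Ai_lead_cmult[OF this refl] refl] Ai_lead_y refl]
  \<comment> \<open>The coefficient is \<open>1 / 8 + 1 / 8 - 1 / 4 = 0\<close>; this serves only to
    show that \<open>z\<close> tends to 0.\<close>
  have "Ai_lead 2 (- 1) (1 / 2 * (1 / 4) + 1 / 2 * (1 / 4) - 1 / 4) z"
    unfolding z_def[abs_def] .
  then show "(z \<longlongrightarrow> 0) at_top" by (rule Ai_lead_tendsto_0) simp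
  show "Ai_lead 2 (- 7 / 2) (- 1 / 64) (\<lambda>x. (airy_N x - wronskian x) / (Ai x)\<^sup>2)"
    by (rule Ai_lead_divide[OF Ai_lead_airy_N_minus_wronskian Ai_lead_Ai_power]) auto
qed auto

section \<open>The integrals of q^2 in the Tracy-Widom exponents\<close>

lemma Ai_lead_q_square: "Ai_lead 2 0 1 (\<lambda>x. (q x)\<^sup>2)"
  by (rule Ai_lead_power[OF Ai_lead_q]) auto

lemma Ai_lead_x_q_square: "Ai_lead 2 1 1 (\<lambda>x. x * (q x)\<^sup>2)"
  by (rule Ai_lead_mult[OF Ai_lead_ident Ai_lead_q_square]) auto

text \<open>\<open>u\<close> and the function \<open>v\<close> below are the counterparts of
  \<open>airy_P\<close> and \<open>Fhat2\<close> with \<open>q\<close> in place of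
  \<open>Ai\<close>: \<open>u' = - q^2\<close> and \<open>v' = - u\<close>.\<close>

definition u :: "real \<Rightarrow> real" where
  "u s = integral {s..} (\<lambda>x. (q x)\<^sup>2)"

definition v :: "real \<Rightarrow> real" where
  "v s = integral {s..} (\<lambda>x. (x - s) * (q x)\<^sup>2)"

lemmas q_square_tail = Ai_lead_tail[OF Ai_lead_q_square zero_less_numeral, folded u_def]
lemmas x_q_square_tail = Ai_lead_tail[OF Ai_lead_x_q_square zero_less_numeral]

lemma eventually_isCont_q: "\<forall>\<^sub>F x in at_top. isCont (\<lambda>x. (q x)\<^sup>2) x" "\<forall>\<^sub>F x in at_top. isCont (\<lambda>x. x * (q x)\<^sup>2) x"
  by (auto intro!: always_eventually continuous_intros isCont_q)

lemma u_eventually_deriv: "\<forall>\<^sub>F s in at_top. (u has_real_derivative - (q s)\<^sup>2) (at s)"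
  using q_square_tail(2)[OF eventually_isCont_q(1)] by simp

lemma Ai_lead_u: "Ai_lead 2 (- 1 / 2) (1 / 2) u"
  by (rule q_square_tail(4)[OF eventually_isCont_q(1)]) auto

text \<open>The integrand of \<open>v\<close> depends on \<open>s\<close>; splitting
  \<open>x - s\<close> produces two tails with fixed integrands. The integrability is recorded for
  separating the two summands in \<open>F_TW1\<close>.\<close>

lemma v_eq: "\<forall>\<^sub>F s in at_top. v s = integral {s..} (\<lambda>x. x * (q x)\<^sup>2) - s * u s
    \<and> (\<lambda>x. (x - s) * (q x)\<^sup>2) integrable_on {s..}"
  using q_square_tail(1)[OF eventually_isCont_q(1)] x_q_square_tail(1)[OF eventually_isCont_q(2)]
proof eventually_elim
  case (elim s)
  have "((\<lambda>x. x * (q x)\<^sup>2 - s * (q x)\<^sup>2) has_integral integral {s..} (\<lambda>x. x * (q x)\<^sup>2) - s * u s) {s..}"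
    unfolding u_def by (intro has_integral_diff has_integral_mult_right integrable_integral elim)
  then show ?case unfolding v_def left_diff_distrib by (auto simp: integral_unique)
qed

lemma v_tendsto_0: "(v \<longlongrightarrow> 0) at_top"
proof (rule Lim_transform_eventually)
  have "((\<lambda>s. s * u s) \<longlongrightarrow> 0) at_top"
    by (rule Ai_lead_tendsto_0[OF Ai_lead_mult[OF Ai_lead_ident Ai_lead_u refl refl refl]]) simp
  from tendsto_diff[OF x_q_square_tail(3)[OF eventually_isCont_q(2)] this]
  show "((\<lambda>s. integral {s..} (\<lambda>x. x * (q x)\<^sup>2) - s * u s) \<longlongrightarrow> 0) at_top" by simp
  show "\<forall>\<^sub>F s in at_top. integral {s..} (\<lambda>x. x * (q x)\<^sup>2) - s * u s = v s"
    using v_eq by eventually_elim simp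
qed

lemma v_eventually_deriv: "\<forall>\<^sub>F s in at_top. (v has_real_derivative - u s) (at s)"
proof -
  \<comment> \<open>To transfer the derivative to \<open>v\<close> the formula must hold in a
    neighbourhood of the point, hence the quantification over a whole ray.\<close>
  have "\<forall>\<^sub>F s in at_top. \<forall>t\<ge>s. v t = integral {t..} (\<lambda>x. x * (q x)\<^sup>2) - t * u t
      \<and> ((\<lambda>s. integral {s..} (\<lambda>x. x * (q x)\<^sup>2) - s * u s) has_real_derivative - u t) (at t)"
  proof (rule eventually_at_top_ge_self, rule eventually_conj)
    show "\<forall>\<^sub>F t in at_top. v t = integral {t..} (\<lambda>x. x * (q x)\<^sup>2) - t * u t"
      using v_eq by eventually_elim simp
    show "\<forall>\<^sub>F t in at_top. ((\<lambda>s. integral {s..} (\<lambda>x. x * (q x)\<^sup>2) - s * u s) has_real_derivative - u t) (at t)"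
      using x_q_square_tail(2)[OF eventually_isCont_q(2)] u_eventually_deriv
    proof eventually_elim
      case (elim t)
      from DERIV_diff[OF elim(1) DERIV_mult[OF DERIV_ident elim(2)]]
      show ?case by (rule DERIV_cong) simp
    qed
  qed
  then obtain a where a: "\<And>t. t \<ge> a \<Longrightarrow> v t = integral {t..} (\<lambda>x. x * (q x)\<^sup>2) - t * u t
      \<and> ((\<lambda>s. integral {s..} (\<lambda>x. x * (q x)\<^sup>2) - s * u s) has_real_derivative - u t) (at t)"
    by (auto simp: eventually_at_top_linorder)
  show ?thesis
    using eventually_gt_at_top[of a]
  proof eventually_elim
    case (elim s)
    show ?case
      by (rule has_field_derivative_transform_within_open[where S = "{a<..}"])
        (use a elim in auto)
  qed
qed

lemma Ai_lead_v: "Ai_lead 2 (- 1) (1 / 4) v"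
  by (rule Ai_lead_integrate[OF v_eventually_deriv v_tendsto_0 Ai_lead_minus[OF Ai_lead_u]]) auto

text \<open>The integrand \<open>q^2 - Ai^2 = Ai^2 (2 y + y^2)\<close> has four factors of
  \<open>Ai\<close>: the nonlinearity shows two factors later than \<open>u\<close> itself.\<close>

lemma Ai_lead_u_minus_airy_P: "Ai_lead 4 (- 3 / 2) (1 / 8) (\<lambda>x. u x - airy_P x)"
proof (rule Ai_lead_integrate)
  show "\<forall>\<^sub>F x in at_top. ((\<lambda>x. u x - airy_P x) has_real_derivative - (q x)\<^sup>2 - - (Ai x)\<^sup>2) (at x)"
    using u_eventually_deriv airy_P_eventually_deriv by eventually_elim (rule DERIV_diff)
  show "((\<lambda>x. u x - airy_P x) \<longlongrightarrow> 0) at_top"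
    using tendsto_diff[OF Ai_lead_tendsto_0[OF Ai_lead_u] airy_P_tendsto_0] by simp
  show "Ai_lead 4 (- 1) (- 1 / 2) (\<lambda>x. - (q x)\<^sup>2 - - (Ai x)\<^sup>2)"
  proof (rule Ai_lead_cong)
    have "Ai_lead 2 (- 1) 0 (\<lambda>x. (y x)\<^sup>2)"
      by (rule Ai_lead_lower[OF Ai_lead_power[OF Ai_lead_y refl refl refl]]) simp
    from Ai_lead_add[OF Ai_lead_cmult[OF Ai_lead_y refl, of 2] this refl]
    have "Ai_lead 2 (- 1) (1 / 2) (\<lambda>x. 2 * y x + (y x)\<^sup>2)" by simp
    then show "Ai_lead 4 (- 1) (- 1 / 2) (\<lambda>x. (- 1) * ((Ai x)\<^sup>2 * (2 * y x + (y x)\<^sup>2)))"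
      by (intro Ai_lead_cmult[OF Ai_lead_mult[OF Ai_lead_Ai_power[of 2]]]) auto
    show "\<forall>\<^sub>F x in at_top. (- 1) * ((Ai x)\<^sup>2 * (2 * y x + (y x)\<^sup>2)) = - (q x)\<^sup>2 - - (Ai x)\<^sup>2"
      using q_eq
    proof eventually_elim
      case (elim x)
      then show ?case by algebra
    qed
  qed
qed auto

lemma Ai_lead_v_minus_Fhat2: "Ai_lead 4 (- 2) (1 / 32) (\<lambda>x. v x - Fhat2 x)"
proof (rule Ai_lead_integrate)
  show "\<forall>\<^sub>F x in at_top. ((\<lambda>x. v x - Fhat2 x) has_real_derivative (- u x) - (- airy_P x)) (at x)"
    using v_eventually_deriv Fhat2_tail(2) by eventually_elim (rule DERIV_diff)
  show "((\<lambda>x. v x - Fhat2 x) \<longlongrightarrow> 0) at_top"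
    using tendsto_diff[OF v_tendsto_0 Fhat2_tail(3)] by simp
  show "Ai_lead 4 (- 3 / 2) (- 1 / 8) (\<lambda>x. (- u x) - (- airy_P x))"
    using Ai_lead_cmult[OF Ai_lead_u_minus_airy_P refl, of "- 1"] by simp
qed auto

section \<open>The case beta = 2\<close>

definition Delta2_main :: "real \<Rightarrow> real" where
  "Delta2_main s = Fhat2 s - v s + (v s)\<^sup>2 / 2"

text \<open>Differentiate once more and replace \<open>u\<close> by \<open>airy_P\<close>,
  \<open>v\<close> by \<open>Fhat2\<close> and \<open>q\<close> by \<open>Ai (1 + y)\<close>,
  keeping only terms with four factors of \<open>Ai\<close>. The result is \<open>2 Ai^2 z\<close>,
  which is where \<open>z\<close> comes from; all replacement errors have at least six factors of
  \<open>Ai\<close>.\<close>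

lemma Ai_lead_Delta2_main_deriv: "Ai_lead 4 (- 9 / 2) (- 1 / 256) (\<lambda>s. u s - airy_P s - v s * u s)"
proof (rule Ai_lead_integrate)
  show "\<forall>\<^sub>F s in at_top. ((\<lambda>s. u s - airy_P s - v s * u s) has_real_derivative
      (Ai s)\<^sup>2 - (q s)\<^sup>2 + (u s)\<^sup>2 + v s * (q s)\<^sup>2) (at s)"
    using u_eventually_deriv airy_P_eventually_deriv v_eventually_deriv
  proof eventually_elim
    case (elim s)
    from DERIV_diff[OF DERIV_diff[OF elim(1,2)] DERIV_mult[OF elim(3,1)]]
    show ?case by (rule DERIV_cong) (simp add: power2_eq_square algebra_simps)
  qed
  have uP: "((\<lambda>s. u s - airy_P s) \<longlongrightarrow> 0) at_top"
    by (rule Ai_lead_tendsto_0[OF Ai_lead_u_minus_airy_P]) simp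
  have "((\<lambda>s. v s * u s) \<longlongrightarrow> 0) at_top"
    using tendsto_mult[OF v_tendsto_0 Ai_lead_tendsto_0[OF Ai_lead_u]] by simp
  from tendsto_diff[OF uP this]
  show "((\<lambda>s. u s - airy_P s - v s * u s) \<longlongrightarrow> 0) at_top" by simp
  show "Ai_lead 4 (- 4) (1 / 64) (\<lambda>s. (Ai s)\<^sup>2 - (q s)\<^sup>2 + (u s)\<^sup>2 + v s * (q s)\<^sup>2)"
  proof (rule Ai_lead_cong)
    have 1: "Ai_lead 4 (- 4) (1 / 64) (\<lambda>s. 2 * ((Ai s)\<^sup>2 * z s))"
      by (rule Ai_lead_cmult[where c = "1 / 128", OF Ai_lead_mult[OF Ai_lead_Ai_power Ai_lead_z]]) auto
    have 2: "Ai_lead 4 (- 4) 0 (\<lambda>s. (Ai s)\<^sup>2 * (y s)\<^sup>2)"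
      by (rule Ai_lead_lower[OF Ai_lead_mult[OF Ai_lead_Ai_power Ai_lead_power[OF Ai_lead_y refl refl refl] refl refl refl]]) simp
    have "Ai_lead 2 (- 1 / 2) 1 (\<lambda>s. u s + airy_P s)"
      by (rule Ai_lead_add[OF Ai_lead_u Ai_lead_airy_P]) simp
    then have 3: "Ai_lead 4 (- 4) 0 (\<lambda>s. (u s - airy_P s) * (u s + airy_P s))"
      by (rule Ai_lead_lower[OF Ai_lead_mult[OF Ai_lead_u_minus_airy_P _ refl refl refl]]) simp
    have 4: "Ai_lead 4 (- 4) 0 (\<lambda>s. (v s - Fhat2 s) * (q s)\<^sup>2)"
      by (rule Ai_lead_lower[OF Ai_lead_mult[OF Ai_lead_v_minus_Fhat2 Ai_lead_q_square refl refl refl]]) simp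
    have "Ai_lead 2 (- 1) 0 (\<lambda>x. (y x)\<^sup>2)"
      by (rule Ai_lead_lower[OF Ai_lead_power[OF Ai_lead_y refl refl refl]]) simp
    from Ai_lead_add[OF Ai_lead_cmult[OF Ai_lead_y refl, of 2] this refl]
    have 5: "Ai_lead 4 (- 4) 0 (\<lambda>s. Fhat2 s * ((Ai s)\<^sup>2 * (2 * y s + (y s)\<^sup>2)))"
      by (rule Ai_lead_lower[OF Ai_lead_mult[OF Ai_lead_Fhat2 Ai_lead_mult[OF Ai_lead_Ai_power _ refl refl refl] refl refl refl]]) simp
    from Ai_lead_add[OF Ai_lead_add[OF Ai_lead_add[OF Ai_lead_diff[OF 1 2 refl] 3 refl] 4 refl] 5 refl]
    show "Ai_lead 4 (- 4) (1 / 64) (\<lambda>s. 2 * ((Ai s)\<^sup>2 * z s) - (Ai s)\<^sup>2 * (y s)\<^sup>2 + (u s - airy_P s) * (u s + airy_P s)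
        + (v s - Fhat2 s) * (q s)\<^sup>2 + Fhat2 s * ((Ai s)\<^sup>2 * (2 * y s + (y s)\<^sup>2)))" by simp
    show "\<forall>\<^sub>F s in at_top. 2 * ((Ai s)\<^sup>2 * z s) - (Ai s)\<^sup>2 * (y s)\<^sup>2 + (u s - airy_P s) * (u s + airy_P s)
        + (v s - Fhat2 s) * (q s)\<^sup>2 + Fhat2 s * ((Ai s)\<^sup>2 * (2 * y s + (y s)\<^sup>2)) =
        (Ai s)\<^sup>2 - (q s)\<^sup>2 + (u s)\<^sup>2 + v s * (q s)\<^sup>2"
      using Ai_eventually_pos q_eq
    proof eventually_elim
      case (elim s)
      then have "2 * ((Ai s)\<^sup>2 * z s) = (Ai s)\<^sup>2 * Fhat2 s + (airy_P s)\<^sup>2 - 2 * ((Ai s)\<^sup>2 * y s)"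
        unfolding z_def by (simp add: field_simps)
      with elim(2) show ?case by algebra
    qed
  qed
qed auto

lemma Ai_lead_Delta2_main: "Ai_lead 4 (- 5) (1 / 1024) Delta2_main"
proof (rule Ai_lead_integrate)
  show "\<forall>\<^sub>F s in at_top. (Delta2_main has_real_derivative u s - airy_P s - v s * u s) (at s)"
    using Fhat2_tail(2) v_eventually_deriv
  proof eventually_elim
    case (elim s)
    from DERIV_add[OF DERIV_diff[OF elim] DERIV_cdivide[OF DERIV_power[OF elim(2), of 2], of 2]]
    show ?case unfolding Delta2_main_def[abs_def] by (rule DERIV_cong) simp
  qed
  show "(Delta2_main \<longlongrightarrow> 0) at_top"
    unfolding Delta2_main_def[abs_def]
    using tendsto_add[OF tendsto_diff[OF Fhat2_tail(3) v_tendsto_0] tendsto_divide[OF tendsto_power[OF v_tendsto_0, of 2] tendsto_const[of 2]]]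
    by simp
qed (use Ai_lead_Delta2_main_deriv in auto)

lemma Ai_lead_Delta2: "Ai_lead 2 (- 4) (1 / 256) (Delta2 q)"
  unfolding Delta2_def[abs_def]
proof (rule Ai_lead_divide)
  have F: "F_TW2 q s = 1 - exp (- v s)" for s
    unfolding F_TW2_def v_def by simp
  show "Ai_lead 2 (- 1) (1 / 4) (F_TW2 q)"
    unfolding F[abs_def] by (rule Ai_lead_exp_remainder_1[OF Ai_lead_v]) auto
  \<comment> \<open>The cubic remainder has six factors of \<open>Ai\<close> and is therefore
    invisible at order \<open>Ai^4\<close>.\<close>
  have "Ai_lead 4 (- 5) 0 (\<lambda>s. exp (- v s) - 1 + v s - (v s)\<^sup>2 / 2)"
    by (rule Ai_lead_lower[OF Ai_lead_exp_remainder_3[OF Ai_lead_v]]) auto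
  from Ai_lead_add[OF Ai_lead_Delta2_main this refl]
  show "Ai_lead 4 (- 5) (1 / 1024) (\<lambda>s. Fhat2 s - F_TW2 q s)"
    unfolding Delta2_main_def F by (simp add: algebra_simps)
qed auto

section \<open>The case beta = 1\<close>

definition a :: "real \<Rightarrow> real" where "a s = integral {s..} Ai"
definition b :: "real \<Rightarrow> real" where "b s = integral {s..} q"
definition w :: "real \<Rightarrow> real" where "w s = (b s + v s) / 2"

lemmas a_tail = Ai_lead_tail[OF Ai_lead_Ai zero_less_one eventually_isCont_Ai, folded a_def]
lemmas b_tail = Ai_lead_tail[OF Ai_lead_q zero_less_one always_eventually[OF allI[OF isCont_q]], folded b_def]

lemma Ai_lead_a: "Ai_lead 1 (- 1 / 2) 1 a" and Ai_lead_b: "Ai_lead 1 (- 1 / 2) 1 b"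
  by (rule a_tail(4) b_tail(4); simp)+

lemma Ai_lead_b_minus_a: "Ai_lead 3 (- 3 / 2) (1 / 12) (\<lambda>s. b s - a s)"
proof (rule Ai_lead_integrate)
  show "\<forall>\<^sub>F s in at_top. ((\<lambda>s. b s - a s) has_real_derivative - q s - - Ai s) (at s)"
    using b_tail(2) a_tail(2) by eventually_elim (rule DERIV_diff)
  show "((\<lambda>s. b s - a s) \<longlongrightarrow> 0) at_top"
    using tendsto_diff[OF b_tail(3) a_tail(3)] by simp
  show "Ai_lead 3 (- 1) (- (1 / 4)) (\<lambda>s. - q s - - Ai s)"
  proof (rule Ai_lead_cong)
    show "Ai_lead 3 (- 1) (- (1 / 4)) (\<lambda>s. - (Ai s * y s))"
      by (rule Ai_lead_minus[OF Ai_lead_mult[OF Ai_lead_Ai Ai_lead_y]]) auto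
    show "\<forall>\<^sub>F s in at_top. - (Ai s * y s) = - q s - - Ai s"
      using q_eq by eventually_elim (simp add: algebra_simps)
  qed
qed auto

text \<open>The leading terms of \<open>Fhat2 / 2\<close> and \<open>a\<^sup>2 / 8\<close> agree, so two differentiations are needed to see their difference.\<close>

lemma Ai_lead_cancellation: "Ai_lead 2 (- 5 / 2) (1 / 32) (\<lambda>s. Fhat2 s / 2 - (a s)\<^sup>2 / 8)"
proof (rule Ai_lead_integrate)
  show "\<forall>\<^sub>F s in at_top. ((\<lambda>s. Fhat2 s / 2 - (a s)\<^sup>2 / 8) has_real_derivative
      - airy_P s / 2 + a s * Ai s / 4) (at s)"
    using Fhat2_tail(2) a_tail(2)
  proof eventually_elim
    case (elim s)
    from DERIV_diff[OF DERIV_cdivide[OF elim(1), of 2] DERIV_cdivide[OF DERIV_power[OF elim(2), of 2], of 8]]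
    show ?case by (rule DERIV_cong) simp
  qed
  show "((\<lambda>s. Fhat2 s / 2 - (a s)\<^sup>2 / 8) \<longlongrightarrow> 0) at_top"
    using tendsto_diff[OF tendsto_divide[OF Fhat2_tail(3) tendsto_const[of 2]]
        tendsto_divide[OF tendsto_power[OF a_tail(3), of 2] tendsto_const[of 8]]] by simp
  show "Ai_lead 2 (- 2) (- 1 / 16) (\<lambda>s. - airy_P s / 2 + a s * Ai s / 4)"
  proof (rule Ai_lead_integrate)
    \<comment> \<open>The derivative is \<open>(Ai^2 + a Ai') / 4\<close>, whose leading terms
      cancel again. Dividing out \<open>Ai'\<close> isolates the integral \<open>a\<close>, so that
      one differentiation removes it and leaves the monomial
      \<open>Ai airy_P / Ai'^2\<close>.\<close>
    define k where "k = (\<lambda>s. (Ai s)\<^sup>2 / deriv Ai s + a s)"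
    show "\<forall>\<^sub>F s in at_top. ((\<lambda>s. - airy_P s / 2 + a s * Ai s / 4) has_real_derivative
        1 / 4 * (deriv Ai s * k s)) (at s)"
      using airy_P_eventually_deriv a_tail(2) eventually_Ai_has_derivatives(1) deriv_Ai_eventually_neg
    proof eventually_elim
      case (elim s)
      from DERIV_add[OF DERIV_cdivide[OF DERIV_minus[OF elim(1)], of 2] DERIV_cdivide[OF DERIV_mult[OF elim(2,3)], of 4]]
      show ?case
        by (rule DERIV_cong) (use elim in \<open>simp add: k_def field_simps power2_eq_square\<close>)
    qed
    have "((\<lambda>s. a s * Ai s) \<longlongrightarrow> 0) at_top"
      using tendsto_mult[OF a_tail(3) Ai_tendsto_0] by simp
    from tendsto_add[OF tendsto_divide[OF tendsto_minus[OF airy_P_tendsto_0] tendsto_const[of 2]] tendsto_divide[OF this tendsto_const[of 4]]]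
    show "((\<lambda>s. - airy_P s / 2 + a s * Ai s / 4) \<longlongrightarrow> 0) at_top" by simp
    have k: "Ai_lead 1 (- 2) (- 1 / 2) k"
    proof (rule Ai_lead_integrate)
      show "\<forall>\<^sub>F s in at_top. (k has_real_derivative Ai s * airy_P s / (deriv Ai s)\<^sup>2) (at s)"
        using a_tail(2) eventually_Ai_has_derivatives deriv_Ai_eventually_neg
      proof eventually_elim
        case (elim s)
        then have "deriv Ai s \<noteq> 0" by simp
        from DERIV_add[OF DERIV_divide[OF DERIV_power[OF elim(2), of 2] elim(3) this] elim(1)] this
        show ?case unfolding k_def
          by (elim DERIV_cong) (simp add: airy_P_def field_simps power2_eq_square)
      qed
      have "Ai_lead 1 (- 1 / 2) (- 1) (\<lambda>s. (Ai s)\<^sup>2 / deriv Ai s)"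
        by (rule Ai_lead_divide[OF Ai_lead_Ai_power Ai_lead_deriv_Ai]) auto
      from Ai_lead_add[OF this Ai_lead_a refl]
      show "(k \<longlongrightarrow> 0) at_top"
        unfolding k_def by (rule Ai_lead_tendsto_0) simp
      show "Ai_lead 1 (- 3 / 2) (1 / 2) (\<lambda>s. Ai s * airy_P s / (deriv Ai s)\<^sup>2)"
        by (rule Ai_lead_divide[OF Ai_lead_mult[OF Ai_lead_Ai Ai_lead_airy_P refl refl refl]
            Ai_lead_power[OF Ai_lead_deriv_Ai refl refl refl]]) auto
    qed auto
    show "Ai_lead 2 (- 3 / 2) (1 / 8) (\<lambda>s. 1 / 4 * (deriv Ai s * k s))"
      by (rule Ai_lead_cmult[where c = "1 / 2", OF Ai_lead_mult[OF Ai_lead_deriv_Ai k]]) auto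
  qed auto
qed auto

lemma Ai_lead_w: "Ai_lead 1 (- 1 / 2) (1 / 2) w"
proof -
  have "Ai_lead 1 (- 1 / 2) 0 v" by (rule Ai_lead_lower[OF Ai_lead_v]) simp
  from Ai_lead_cmult[OF Ai_lead_add[OF Ai_lead_b this refl] refl, of "1 / 2"]
  show ?thesis unfolding w_def[abs_def] by simp
qed

lemma F_TW1_eq: "\<forall>\<^sub>F s in at_top. F_TW1 q s = 1 - exp (- w s)"
  using b_tail(1) v_eq
proof eventually_elim
  case (elim s)
  have "integral {s..} (\<lambda>x. q x + (x - s) * (q x)\<^sup>2) = b s + v s"
    unfolding b_def v_def by (rule integral_add) (use elim in auto)
  then show ?case unfolding F_TW1_def w_def by simp
qed

text \<open>Up to the cubic remainder, \<open>Fhat1 - F_TW1\<close> is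
  \<open>a / 2 - w + w^2 / 2\<close>. Replacing \<open>b\<close> by \<open>a\<close> and
  \<open>v\<close> by \<open>Fhat2\<close> in the linear part, and \<open>(b + v)^2\<close> by
  \<open>a^2\<close> in the quadratic part, leaves \<open>- (Fhat2 / 2 - a^2 / 8)\<close>. Every
  correction has at least three factors of \<open>Ai\<close>.\<close>

lemma Ai_lead_Delta1: "Ai_lead 1 (- 2) (- 1 / 16) (Delta1 q)"
  unfolding Delta1_def[abs_def]
proof (rule Ai_lead_divide)
  show "Ai_lead 1 (- 1 / 2) (1 / 2) (F_TW1 q)"
    by (rule Ai_lead_cong[OF Ai_lead_exp_remainder_1[OF Ai_lead_w]])
      (use F_TW1_eq in \<open>auto elim: eventually_mono\<close>)
  show "Ai_lead 2 (- 5 / 2) (- 1 / 32) (\<lambda>s. Fhat1 s - F_TW1 q s)"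
  proof (rule Ai_lead_cong)
    have 1: "Ai_lead 2 (- 5 / 2) 0 (\<lambda>s. exp (- w s) - 1 + w s - (w s)\<^sup>2 / 2)"
      by (rule Ai_lead_lower[OF Ai_lead_exp_remainder_3[OF Ai_lead_w]]) auto
    have 2: "Ai_lead 2 (- 5 / 2) 0 (\<lambda>s. b s - a s)"
      by (rule Ai_lead_lower[OF Ai_lead_b_minus_a]) simp
    have 3: "Ai_lead 2 (- 5 / 2) 0 (\<lambda>s. v s - Fhat2 s)"
      by (rule Ai_lead_lower[OF Ai_lead_v_minus_Fhat2]) simp
    have "Ai_lead 2 (- 1) 0 (\<lambda>s. b s - a s)"
      by (rule Ai_lead_lower[OF Ai_lead_b_minus_a]) simp
    from Ai_lead_add[OF this Ai_lead_v refl]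
    have "Ai_lead 2 (- 1) (1 / 4) (\<lambda>s. (b s - a s) + v s)" by simp
    \<comment> \<open>This product is \<open>(b + v)^2 - a^2\<close>, factored as a difference of
      squares with \<open>b + v = 2 w\<close>.\<close>
    from Ai_lead_mult[OF this Ai_lead_add[OF Ai_lead_cmult[OF Ai_lead_w refl, of 2] Ai_lead_a refl] refl refl refl]
    have 4: "Ai_lead 2 (- 5 / 2) 0 (\<lambda>s. ((b s - a s) + v s) * (2 * w s + a s))"
      by (rule Ai_lead_lower) simp
    from Ai_lead_add[OF Ai_lead_add[OF Ai_lead_add[OF Ai_lead_add[OF Ai_lead_minus[OF Ai_lead_cancellation] 1 refl]
        Ai_lead_cmult[OF 2 refl, of "- 1 / 2"] refl] Ai_lead_cmult[OF 3 refl, of "- 1 / 2"] refl] Ai_lead_cmult[OF 4 refl, of "1 / 8"] refl]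
    show "Ai_lead 2 (- 5 / 2) (- 1 / 32) (\<lambda>s. - (Fhat2 s / 2 - (a s)\<^sup>2 / 8) + (exp (- w s) - 1 + w s - (w s)\<^sup>2 / 2)
        + (- 1 / 2) * (b s - a s) + (- 1 / 2) * (v s - Fhat2 s) + 1 / 8 * (((b s - a s) + v s) * (2 * w s + a s)))"
      by simp
    show "\<forall>\<^sub>F s in at_top. - (Fhat2 s / 2 - (a s)\<^sup>2 / 8) + (exp (- w s) - 1 + w s - (w s)\<^sup>2 / 2)
        + (- 1 / 2) * (b s - a s) + (- 1 / 2) * (v s - Fhat2 s) + 1 / 8 * (((b s - a s) + v s) * (2 * w s + a s)) =
        Fhat1 s - F_TW1 q s"
      using F_TW1_eq
    proof eventually_elim
      case (elim s)
      show ?case unfolding elim Fhat1_def a_def[symmetric] w_def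
        by (simp add: field_simps power2_eq_square)
    qed
  qed
qed auto

section \<open>Insertion of the explicit asymptotics of Ai\<close>

lemma Delta1_asymp:
  "Delta1 q \<sim>[at_top]
     (\<lambda>s. - (1 / (2 ^ 5 * pi powr (1 / 2))) * s powr (- 9 / 4) * exp (- (2 / 3) * s powr (3 / 2)))"
proof -
  have "Delta1 q \<sim>[at_top] (\<lambda>s. (- 1 / 16) * (Ai s ^ 1 * s powr (- 2)))"
    by (rule Ai_lead_imp_asymp_equiv[OF Ai_lead_Delta1]) simp
  also have "\<dots> \<sim>[at_top] (\<lambda>s. (- 1 / 16) * ((exp (- (2 / 3) * s powr (3 / 2)) * s powr (- 1 / 4) / (2 * sqrt pi)) ^ 1 * s powr (- 2)))"
    by (intro asymp_equiv_intros Ai_asymp_equiv)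
  also have "\<dots> = (\<lambda>s. - (1 / (2 ^ 5 * pi powr (1 / 2))) * s powr (- 9 / 4) * exp (- (2 / 3) * s powr (3 / 2)))"
  proof
    fix s :: real
    have "s powr (- 9 / 4) = s powr (- 1 / 4) * s powr (- 2)"
      by (simp add: powr_add[symmetric])
    then show "(- 1 / 16) * ((exp (- (2 / 3) * s powr (3 / 2)) * s powr (- 1 / 4) / (2 * sqrt pi)) ^ 1 * s powr (- 2)) =
        - (1 / (2 ^ 5 * pi powr (1 / 2))) * s powr (- 9 / 4) * exp (- (2 / 3) * s powr (3 / 2))"
      by (simp add: powr_half_sqrt)
  qed
  finally show ?thesis .
qed

lemma Delta2_asymp:
  "Delta2 q \<sim>[at_top]
     (\<lambda>s. 1 / (2 ^ 10 * pi) * s powr (- 9 / 2) * exp (- (4 / 3) * s powr (3 / 2)))"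
proof -
  have "Delta2 q \<sim>[at_top] (\<lambda>s. (1 / 256) * (Ai s ^ 2 * s powr (- 4)))"
    by (rule Ai_lead_imp_asymp_equiv[OF Ai_lead_Delta2]) simp
  also have "\<dots> \<sim>[at_top] (\<lambda>s. (1 / 256) * ((exp (- (2 / 3) * s powr (3 / 2)) * s powr (- 1 / 4) / (2 * sqrt pi)) ^ 2 * s powr (- 4)))"
    by (intro asymp_equiv_intros Ai_asymp_equiv)
  also have "\<dots> = (\<lambda>s. 1 / (2 ^ 10 * pi) * s powr (- 9 / 2) * exp (- (4 / 3) * s powr (3 / 2)))"
  proof
    fix s :: real
    have 1: "s powr (- 9 / 2) = s powr (- 1 / 4) * s powr (- 1 / 4) * s powr (- 4)"
      by (simp add: powr_add[symmetric])
    have 2: "exp (- (4 / 3) * s powr (3 / 2)) = exp (- (2 / 3) * s powr (3 / 2)) * exp (- (2 / 3) * s powr (3 / 2))"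
      by (simp add: exp_add[symmetric])
    show "(1 / 256) * ((exp (- (2 / 3) * s powr (3 / 2)) * s powr (- 1 / 4) / (2 * sqrt pi)) ^ 2 * s powr (- 4)) =
        1 / (2 ^ 10 * pi) * s powr (- 9 / 2) * exp (- (4 / 3) * s powr (3 / 2))"
      unfolding 1 2 by (simp add: power2_eq_square)
  qed
  finally show ?thesis .
qed

text \<open>The comparison is made at the level of monomials in \<open>Ai\<close> and
  \<open>x\<close>, where \<open>(- 1 / 16)^2 = 1 / 256\<close> and both exponents double.\<close>

lemma Delta2_asymp_Delta1: "Delta2 q \<sim>[at_top] (\<lambda>s. (Delta1 q s)\<^sup>2)"
proof -
  have "Delta2 q \<sim>[at_top] (\<lambda>s. (1 / 256) * (Ai s ^ 2 * s powr (- 4)))"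
    by (rule Ai_lead_imp_asymp_equiv[OF Ai_lead_Delta2]) simp
  also have "(\<lambda>s. (Delta1 q s)\<^sup>2) \<sim>[at_top] (\<lambda>s. (1 / 256) * (Ai s ^ 2 * s powr (- 4)))"
    by (rule Ai_lead_imp_asymp_equiv[OF Ai_lead_power[OF Ai_lead_Delta1]]) (auto simp: power2_eq_square)
  note asymp_equiv_symI[OF this]
  finally show ?thesis .
qed

end

theorem theorem5p4:
  fixes q :: "real \<Rightarrow> real"
  assumes "hastings_mcleod q"
  shows "(Delta1 q \<sim>[at_top]
           (\<lambda>s. - (1 / (2 ^ 5 * pi powr (1 / 2))) * s powr (- 9 / 4) * exp (- (2 / 3) * s powr (3 / 2))))
       \<and> (Delta2 q \<sim>[at_top]
           (\<lambda>s. 1 / (2 ^ 10 * pi) * s powr (- 9 / 2) * exp (- (4 / 3) * s powr (3 / 2))))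
       \<and> (Delta2 q \<sim>[at_top] (\<lambda>s. (Delta1 q s)\<^sup>2))"
proof -
  interpret hastings_mcleod_solution q by unfold_locales (rule assms)
  show ?thesis
    using Delta1_asymp Delta2_asymp Delta2_asymp_Delta1 by blast
qed

end
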